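(* Let $E$ be an ordered Banach space whose positive cone $K$ is normal, let $\omega>0$ and $\tau>0$, let $A:D(A)\subset E\to E$ be a closed linear operator such that $-A$ generates a positive compact $C_0$-semigroup $T(t)$ $(t\ge 0)$ on $E$, and let $F:\mathbb{R}\times E\times E\to E$ be a continuous mapping which is $\omega$-periodic in $t$. Assume that the delayed evolution equation $$u'(t)+Au(t)=F(t,u(t),u(t-\tau)),\qquad t\in\mathbb{R},$$ has an $\omega$-periodic lower solution $v_0$ and an $\omega$-periodic upper solution $w_0$, $v_0,w_0\in C^1_\omega(\mathbb{R},E)\cap C_\omega(\mathbb{R},E_1)$, with $v_0\le w_0$. Suppose there exists a constant $C\ge 0$ such that for all $t\in\mathbb{R}$ and all $x_1,x_2,y_1,y_2\in E$ with $v_0(t)\le x_1\le x_2\le w_0(t)$ and $v_0(t-\tau)\le y_1\le y_2\le w_0(t-\tau)$, $$F(t,x_2,y_2)-F(t,x_1,y_1)\ge -C(x_2-x_1).$$ Then the equation has a minimal $\omega$-periodic mild solution $\underline{u}$ and a maximal $\omega$-periodic mild solution $\overline{u}$ between $v_0$ and $w_0$, and these can be obtained as limits of the monotone iterative sequences starting from $v_0$ and $w_0$, respectively.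
   Context: The cone is $K=\{u\in E: u\ge\theta\}$, $\theta$ the zero element; normal with constant $N$ means $\theta\le x\le y$ implies $\|x\|\le N\|y\|$. $C_\omega(\mathbb{R},E)$ is the Banach space of continuous $\omega$-periodic functions $u:\mathbb{R}\to E$ with norm $\|u\|_C=\max_{t\in[0,\omega]}\|u(t)\|$, ordered pointwise ($u\le v$ iff $u(t)\le v(t)$ for all $t$). $C^1_\omega(\mathbb{R},E)$ is the set of $C^1$ functions in $C_\omega(\mathbb{R},E)$. $E_1=D(A)$ with the graph norm $\|\cdot\|+\|A\cdot\|$. A $C_0$-semigroup $T(t)$ is positive if $T(t)x\ge\theta$ for all $x\ge\theta$, $t\ge0$; it is compact if $T(t)$ is a compact operator for every $t>0$. Its growth exponent is $\nu_0=\inf\{\nu\in\mathbb{R}: \exists M\ge1,\ \|T(t)\|\le Me^{\nu t}\ \forall t\ge0\}$. A function $v_0\in C^1_\omega(\mathbb{R},E)\cap C_\omega(\mathbb{R},E_1)$ is an $\omega$-periodic lower solution if $v_0'(t)+Av_0(t)\le F(t,v_0(t),v_0(t-\tau))$ for all $t\in\mathbb{R}$; an $\omega$-periodic upper solution is defined with the inequality reversed. An $\omega$-periodic mild solution is $u\in C_\omega(\mathbb{R},E)$ with $u(t)=T(t-s)u(s)+\int_s^tT(t-r)F(r,u(r),u(r-\tau))\,dr$ for all $s\le t$. Minimal and maximal between $v_0$ and $w_0$ means: $v_0\le\underline{u}\le\overline{u}\le w_0$, and every $\omega$-periodic mild solution $u$ with $v_0\le u\le w_0$ satisfies $\underline{u}\le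 u\le\overline{u}$. Monotone iterative sequences: take a constant $C$ as in the hypothesis, enlarged if necessary so that $C>\nu_0$, put $S(t)=e^{-Ct}T(t)$ and $$(Qu)(t)=(I-S(\omega))^{-1}\int_{t-\omega}^tS(t-s)\big(F(s,u(s),u(s-\tau))+Cu(s)\big)\,ds .$$ The sequences are $v_i=Qv_{i-1}$, $w_i=Qw_{i-1}$ $(i\ge1)$; they satisfy $v_0\le v_1\le\cdots\le v_i\le\cdots\le w_i\le\cdots\le w_1\le w_0$, and "obtained" means $v_i\to\underline{u}$, $w_i\to\overline{u}$ in $C_\omega(\mathbb{R},E)$. *)

theory Defs
  imports "HOL-Analysis.Analysis"
begin

text \<open>The ordered Banach space is a type of sort \<open>{banach, ordered_real_vector}\<close>.
  These classes do not relate the order to the norm: closedness of the positive cone, which is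
  part of the notion of an ordered Banach space, and normality are stated separately.\<close>

definition positive_cone :: "'a::ordered_real_vector set" where
  "positive_cone = {u. 0 \<le> u}"

definition normal_cone :: "'a::real_normed_vector set \<Rightarrow> bool" where
  "normal_cone K \<longleftrightarrow> (\<exists>N. \<forall>x y. x \<in> K \<longrightarrow> y - x \<in> K \<longrightarrow> norm x \<le> N * norm y)"

definition closed_linear_operator ::
    "'a::real_normed_vector set \<Rightarrow> ('a \<Rightarrow> 'a) \<Rightarrow> bool" where
  "closed_linear_operator D A \<longleftrightarrow>
     subspace D \<and>
     (\<forall>x\<in>D. \<forall>y\<in>D. A (x + y) = A x + A y) \<and>
     (\<forall>c. \<forall>x\<in>D. A (c *\<^sub>R x) = c *\<^sub>R A x) \<and>
     closed {(x, A x) | x. x \<in> D}"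

text \<open>Only the values \<open>T t\<close> with \<open>t \<ge> 0\<close> matter in the following notions.\<close>

definition C0_semigroup :: "(real \<Rightarrow> 'a::real_normed_vector \<Rightarrow>\<^sub>L 'a) \<Rightarrow> bool" where
  "C0_semigroup T \<longleftrightarrow>
     T 0 = id_blinfun \<and>
     (\<forall>s\<ge>0. \<forall>t\<ge>0. T (s + t) = T s o\<^sub>L T t) \<and>
     (\<forall>x. ((\<lambda>t. T t x) \<longlongrightarrow> x) (at_right 0))"

text \<open>\<open>B\<close> with domain \<open>D\<close> is the infinitesimal generator of \<open>T\<close>; values of \<open>B\<close> outside
  \<open>D\<close> are irrelevant.\<close>

definition generates ::
    "'a::real_normed_vector set \<Rightarrow> ('a \<Rightarrow> 'a) \<Rightarrow> (real \<Rightarrow> 'a \<Rightarrow>\<^sub>L 'a) \<Rightarrow> bool" where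
  "generates D B T \<longleftrightarrow>
     D = {x. \<exists>y. ((\<lambda>h. (1 / h) *\<^sub>R (T h x - x)) \<longlongrightarrow> y) (at_right 0)} \<and>
     (\<forall>x\<in>D. ((\<lambda>h. (1 / h) *\<^sub>R (T h x - x)) \<longlongrightarrow> B x) (at_right 0))"

definition positive_semigroup ::
    "(real \<Rightarrow> 'a::{real_normed_vector, ordered_real_vector} \<Rightarrow>\<^sub>L 'a) \<Rightarrow> bool" where
  "positive_semigroup T \<longleftrightarrow> (\<forall>t\<ge>0. \<forall>x\<ge>0. 0 \<le> T t x)"

definition compact_operator :: "('a::real_normed_vector \<Rightarrow>\<^sub>L 'a) \<Rightarrow> bool" where
  "compact_operator S \<longleftrightarrow> (\<forall>B. bounded B \<longrightarrow> compact (closure (blinfun_apply S ` B)))"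

definition compact_semigroup :: "(real \<Rightarrow> 'a::real_normed_vector \<Rightarrow>\<^sub>L 'a) \<Rightarrow> bool" where
  "compact_semigroup T \<longleftrightarrow> (\<forall>t>0. compact_operator (T t))"

text \<open>Extended-real valued, because the infimum may be \<open>-\<infinity>\<close> (e.g. for nilpotent
  semigroups).\<close>

definition growth_exponent :: "(real \<Rightarrow> 'a::real_normed_vector \<Rightarrow>\<^sub>L 'a) \<Rightarrow> ereal" where
  "growth_exponent T =
     Inf (ereal ` {\<nu>. \<exists>M\<ge>1. \<forall>t\<ge>0. norm (T t) \<le> M * exp (\<nu> * t)})"

definition C_per :: "real \<Rightarrow> (real \<Rightarrow> 'a::real_normed_vector) set" where
  "C_per \<omega> = {u. continuous_on UNIV u \<and> (\<forall>t. u (t + \<omega>) = u t)}"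

definition C1_per :: "real \<Rightarrow> (real \<Rightarrow> 'a::real_normed_vector) set" where
  "C1_per \<omega> = {u \<in> C_per \<omega>. u C1_differentiable_on UNIV}"

definition graph_norm :: "('a::real_normed_vector \<Rightarrow> 'a) \<Rightarrow> 'a \<Rightarrow> real" where
  "graph_norm A x = norm x + norm (A x)"

text \<open>\<open>C\<^sub>\<omega>(\<real>, E\<^sub>1)\<close>, where \<open>E\<^sub>1 = D\<close> carries the graph norm of \<open>A\<close>.\<close>

definition C_per_graph ::
    "real \<Rightarrow> 'a::real_normed_vector set \<Rightarrow> ('a \<Rightarrow> 'a) \<Rightarrow> (real \<Rightarrow> 'a) set" where
  "C_per_graph \<omega> D A =
     {u. (\<forall>t. u t \<in> D) \<and> (\<forall>t. ((\<lambda>s. graph_norm A (u s - u t)) \<longlongrightarrow> 0) (at t)) \<and>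
         (\<forall>t. u (t + \<omega>) = u t)}"

definition C_per_norm :: "real \<Rightarrow> (real \<Rightarrow> 'a::real_normed_vector) \<Rightarrow> real" where
  "C_per_norm \<omega> u = (SUP t\<in>{0..\<omega>}. norm (u t))"

definition tendsto_C_per ::
    "real \<Rightarrow> (nat \<Rightarrow> real \<Rightarrow> 'a::real_normed_vector) \<Rightarrow> (real \<Rightarrow> 'a) \<Rightarrow> bool" where
  "tendsto_C_per \<omega> v u \<longleftrightarrow>
     (\<forall>i. v i \<in> C_per \<omega>) \<and> u \<in> C_per \<omega> \<and>
     (\<lambda>i. C_per_norm \<omega> (\<lambda>t. v i t - u t)) \<longlonglongrightarrow> 0"

text \<open>The order on functions \<open>real \<Rightarrow> 'a\<close> is the pointwise one of the library.\<close>

definition lower_solution ::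
    "'a::{real_normed_vector, ordered_real_vector} set \<Rightarrow> ('a \<Rightarrow> 'a) \<Rightarrow>
     (real \<Rightarrow> 'a \<Rightarrow> 'a \<Rightarrow> 'a) \<Rightarrow> real \<Rightarrow> real \<Rightarrow> (real \<Rightarrow> 'a) \<Rightarrow> bool" where
  "lower_solution D A F \<omega> \<tau> v \<longleftrightarrow>
     v \<in> C1_per \<omega> \<inter> C_per_graph \<omega> D A \<and>
     (\<forall>t. vector_derivative v (at t) + A (v t) \<le> F t (v t) (v (t - \<tau>)))"

definition upper_solution ::
    "'a::{real_normed_vector, ordered_real_vector} set \<Rightarrow> ('a \<Rightarrow> 'a) \<Rightarrow>
     (real \<Rightarrow> 'a \<Rightarrow> 'a \<Rightarrow> 'a) \<Rightarrow> real \<Rightarrow> real \<Rightarrow> (real \<Rightarrow> 'a) \<Rightarrow> bool" where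
  "upper_solution D A F \<omega> \<tau> w \<longleftrightarrow>
     w \<in> C1_per \<omega> \<inter> C_per_graph \<omega> D A \<and>
     (\<forall>t. vector_derivative w (at t) + A (w t) \<ge> F t (w t) (w (t - \<tau>)))"

definition periodic_mild_solution ::
    "(real \<Rightarrow> 'a::banach \<Rightarrow>\<^sub>L 'a) \<Rightarrow> (real \<Rightarrow> 'a \<Rightarrow> 'a \<Rightarrow> 'a) \<Rightarrow>
     real \<Rightarrow> real \<Rightarrow> (real \<Rightarrow> 'a) \<Rightarrow> bool" where
  "periodic_mild_solution T F \<omega> \<tau> u \<longleftrightarrow>
     u \<in> C_per \<omega> \<and>
     (\<forall>s t. s \<le> t \<longrightarrow>
        u t = T (t - s) (u s) + integral {s..t} (\<lambda>r. T (t - r) (F r (u r) (u (r - \<tau>)))))"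

definition minimal_maximal_mild_solutions ::
    "(real \<Rightarrow> 'a::{banach, ordered_real_vector} \<Rightarrow>\<^sub>L 'a) \<Rightarrow> (real \<Rightarrow> 'a \<Rightarrow> 'a \<Rightarrow> 'a) \<Rightarrow>
     real \<Rightarrow> real \<Rightarrow> (real \<Rightarrow> 'a) \<Rightarrow> (real \<Rightarrow> 'a) \<Rightarrow> (real \<Rightarrow> 'a) \<Rightarrow> (real \<Rightarrow> 'a) \<Rightarrow> bool" where
  "minimal_maximal_mild_solutions T F \<omega> \<tau> v w umin umax \<longleftrightarrow>
     periodic_mild_solution T F \<omega> \<tau> umin \<and> periodic_mild_solution T F \<omega> \<tau> umax \<and>
     v \<le> umin \<and> umin \<le> umax \<and> umax \<le> w \<and>
     (\<forall>u. periodic_mild_solution T F \<omega> \<tau> u \<and> v \<le> u \<and> u \<le> w \<longrightarrow> umin \<le> u \<and> u \<le> umax)"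

definition damped_semigroup ::
    "real \<Rightarrow> (real \<Rightarrow> 'a::real_normed_vector \<Rightarrow>\<^sub>L 'a) \<Rightarrow> real \<Rightarrow> 'a \<Rightarrow>\<^sub>L 'a" where
  "damped_semigroup C T t = exp (- C * t) *\<^sub>R T t"

text \<open>The inverse of \<open>I - S(\<omega>)\<close> is taken as a function with \<^const>\<open>inv\<close>, so it is meaningful
  only when \<open>I - S(\<omega>)\<close> is bijective; \<open>growth_exponent T < C\<close> ensures this.\<close>

definition iteration_operator ::
    "(real \<Rightarrow> 'a::banach \<Rightarrow>\<^sub>L 'a) \<Rightarrow> (real \<Rightarrow> 'a \<Rightarrow> 'a \<Rightarrow> 'a) \<Rightarrow>
     real \<Rightarrow> real \<Rightarrow> real \<Rightarrow> (real \<Rightarrow> 'a) \<Rightarrow> real \<Rightarrow> 'a" where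
  "iteration_operator T F \<omega> \<tau> C u t =
     inv (blinfun_apply (id_blinfun - damped_semigroup C T \<omega>))
       (integral {t - \<omega>..t}
          (\<lambda>s. damped_semigroup C T (t - s) (F s (u s) (u (s - \<tau>)) + C *\<^sub>R u s)))"

end

theory Submission
  imports Defs
begin

text \<open>Replacing \<open>T\<close> by \<open>S t = exp (- C' t) T t\<close> and \<open>F\<close> by \<open>g t x y = F t x y + C' x\<close> does not change the
  mild solutions, makes the semigroup exponentially stable and \<open>g\<close> monotone on the order interval.
  Periodic mild solutions are then the fixed points of \<open>Q\<close>, which is monotone because \<open>S\<close> and
  \<open>(I - S \<omega>)\<inverse> = (\<Sum>n. S (n \<omega>))\<close> are positive. Normality bounds \<open>g\<close> along the order
  interval; compactness of \<open>S\<close> then puts all values of \<open>Q u\<close> into one compact set, on which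
  \<open>S h\<close> tends to the identity uniformly as \<open>h \<rightarrow> 0\<close>, so the functions \<open>Q u\<close> are
  equicontinuous. A monotone sequence in a compact set converges when the cone is normal;
  equicontinuity makes the convergence of the iterates uniform, and the limit is a fixed point.\<close>

section \<open>Strongly continuous semigroups\<close>

text \<open>The nonlinear problem is reduced to a linear one with a source depending on time alone:
  \<open>periodic_solution f\<close> is the unique \<open>\<omega>\<close>-periodic mild solution of
  the damped equation with source \<open>f\<close>, and \<open>Q u\<close> is this operator at the
  source \<open>N u\<close>. The delay is thus invisible to the linear theory. Uniqueness is used
  twice. It turns periodic mild solutions into fixed points, and it turns differential inequalities
  into order inequalities: \<open>v0\<close> is differentiable with values in \<open>D\<close>,
  hence a mild solution with its own residual \<open>v0' + A v0\<close> as source, hence equal to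
  the linear periodic solution for that residual plus \<open>C' v0\<close>. The residual lies below
  \<open>F\<close>, so monotonicity of the linear operator yields \<open>v0 \<le> Q v0\<close>; the
  argument for \<open>w0\<close> is dual. The main obstacle is that the order interval is bounded
  but need not be compact, while \<open>g\<close> is merely continuous. No uniform continuity of
  \<open>g\<close> on bounded sets is available, so limits under \<open>g\<close> are taken only
  along functions with values in one compact set.\<close>

lemma uniform_boundedness_sequence:
  fixes f :: "nat \<Rightarrow> 'a::banach \<Rightarrow>\<^sub>L 'b::real_normed_vector"
  assumes "\<And>x. bounded (range (\<lambda>n. f n x))"
  shows "bounded (range f)"
proof -
  define C where "C k = {x. \<forall>n. norm (f n x) \<le> real k}" for k
  have C: "closed (C k)" for k
  proof -
    have "closed (\<Inter>n. {x. norm (f n x) \<le> real k})"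
      by (intro closed_INT ballI closed_Collect_le continuous_intros)
    moreover have "C k = (\<Inter>n. {x. norm (f n x) \<le> real k})"
      by (auto simp: C_def)
    ultimately show ?thesis by simp
  qed
  have un: "(\<Union>k. C k) = UNIV"
  proof -
    have "\<exists>k. x \<in> C k" for x
    proof -
      obtain b where b: "\<And>n. norm (f n x) \<le> b"
        using assms[of x] by (auto simp: bounded_iff)
      obtain k where "b \<le> real k" using real_arch_simple by blast
      with b show ?thesis by (auto simp: C_def intro: order_trans)
    qed
    then show ?thesis by auto
  qed
  \<comment> \<open>Baire category: the space is complete and is covered by the closed sets
    \<open>C k\<close>, so they cannot all have empty interior.\<close>
  have "\<exists>k. interior (C k) \<noteq> {}"
  proof (rule ccontr)
    assume neg: "\<nexists>k. interior (C k) \<noteq> {}"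
    have "Met_TC.mtopology interior_of \<Union>(range C) = ({} :: 'a set)"
    proof (rule Met_TC.metric_Baire_category_alt)
      show "Met_TC.mcomplete TYPE('a)"
        by (metis Met_TC.mcomplete_def MCauchy_iff_Cauchy Cauchy_convergent convergent_def limitin_iff_tendsto)
    qed (use neg C in \<open>auto simp: interior_of_eq_empty\<close>)
    then show False using un by simp
  qed
  then obtain k x0 r where r: "r > 0" "ball x0 r \<subseteq> C k"
    by (metis equals0I mem_interior)
  \<comment> \<open>A vector scaled to norm \<open>r / 2\<close> is a difference of two points of
    the ball, which costs \<open>2 * real k\<close>; undoing the scaling contributes the factor
    \<open>2 / r\<close>.\<close>
  have "norm (f n) \<le> 4 * real k / r" for n
  proof (rule norm_blinfun_bound)
    show "0 \<le> 4 * real k / r" using r by simp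
    fix x
    show "norm (f n x) \<le> 4 * real k / r * norm x"
    proof (cases "x = 0")
      case False
      define c where "c = r / (2 * norm x)"
      have c: "c > 0" using r False by (simp add: c_def)
      have "norm (c *\<^sub>R x) = r / 2" using r False by (simp add: c_def)
      then have "x0 + c *\<^sub>R x \<in> ball x0 r" using r by (simp add: dist_norm)
      moreover have "x0 \<in> ball x0 r" using r by simp
      ultimately have "norm (f n (x0 + c *\<^sub>R x)) \<le> real k" "norm (f n x0) \<le> real k"
        using r unfolding C_def by blast+
      moreover have "f n (c *\<^sub>R x) = f n (x0 + c *\<^sub>R x) - f n x0"
        by (simp add: blinfun.add_right)
      ultimately have "norm (f n (c *\<^sub>R x)) \<le> 2 * real k"
        by (smt (verit) norm_triangle_ineq4)
      then have "c * norm (f n x) \<le> 2 * real k"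
        using c by (simp add: blinfun.scaleR_right)
      then show ?thesis
        using c r False by (simp add: c_def field_simps)
    qed simp
  qed
  then show ?thesis by (auto simp: bounded_iff)
qed

section \<open>Growth bounds from strong continuity at zero\<close>

lemma C0_semigroup_zero: "C0_semigroup T \<Longrightarrow> T 0 = id_blinfun"
  by (simp add: C0_semigroup_def)

lemma C0_semigroup_add:
  "C0_semigroup T \<Longrightarrow> 0 \<le> s \<Longrightarrow> 0 \<le> t \<Longrightarrow> T (s + t) x = T s (T t x)"
  by (simp add: C0_semigroup_def)

text \<open>Otherwise there are times \<open>t n\<close> tending to zero with unbounded operator
  norms. Strong continuity makes every sequence \<open>T (t n) x\<close> convergent, hence bounded,
  against the uniform boundedness principle.\<close>

lemma C0_semigroup_bounded_near_zero:
  fixes T :: "real \<Rightarrow> 'a::banach \<Rightarrow>\<^sub>L 'a"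
  assumes "C0_semigroup T"
  shows "\<exists>d>0. \<exists>M\<ge>1. \<forall>t\<in>{0..d}. norm (T t) \<le> M"
proof (rule ccontr)
  assume neg: "\<not> ?thesis"
  have "\<exists>t. t \<in> {0..inverse (real (Suc n))} \<and> norm (T t) > real (Suc n)" for n
  proof -
    have "inverse (real (Suc n)) > 0" "real (Suc n) \<ge> 1" by auto
    then show ?thesis using neg by (meson not_le)
  qed
  then obtain t where t: "\<And>n. t n \<in> {0..inverse (real (Suc n))}"
    and big: "\<And>n. norm (T (t n)) > real (Suc n)" by metis
  \<comment> \<open>Strong continuity is a limit along \<open>at_right 0\<close>, so time zero has
    to be excluded; there the norm is at most 1.\<close>
  have pos: "t n > 0" for n
  proof -
    have "t n \<noteq> 0"
      using big[of n] norm_blinfun_id_le[where 'a='a] C0_semigroup_zero[OF assms] by auto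
    then show ?thesis using t[of n] by auto
  qed
  have "t \<longlonglongrightarrow> 0"
    by (rule tendsto_sandwich[OF _ _ tendsto_const LIMSEQ_inverse_real_of_nat])
      (use t in \<open>auto intro!: always_eventually\<close>)
  then have "filterlim t (at_right 0) sequentially"
    using pos by (simp add: filterlim_at order_less_imp_not_eq2)
  then have "(\<lambda>n. T (t n) x) \<longlonglongrightarrow> x" for x
    using assms filterlim_compose unfolding C0_semigroup_def by blast
  then have "bounded (range (\<lambda>n. T (t n) x))" for x
    using convergent_imp_bounded by blast
  then have "bounded (range (\<lambda>n. T (t n)))"
    by (rule uniform_boundedness_sequence)
  then obtain b where b: "\<And>n. norm (T (t n)) \<le> b" by (auto simp: bounded_iff)
  obtain n where "b \<le> real n" using real_arch_simple by blast
  with b[of n] big[of n] show False by simp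
qed

lemma C0_semigroup_exponential_bound:
  fixes T :: "real \<Rightarrow> 'a::banach \<Rightarrow>\<^sub>L 'a"
  assumes "C0_semigroup T"
  shows "\<exists>\<nu>. \<exists>M\<ge>1. \<forall>t\<ge>0. norm (T t) \<le> M * exp (\<nu> * t)"
proof -
  obtain d M where d: "d > 0" "M \<ge> 1" and M: "\<And>t. t \<in> {0..d} \<Longrightarrow> norm (T t) \<le> M"
    using C0_semigroup_bounded_near_zero[OF assms] by metis
  have *: "norm (T (real n * d + r)) \<le> M * M ^ n" if "r \<in> {0..d}" for n r
  proof (induction n)
    case 0
    then show ?case using M that by simp
  next
    case (Suc n)
    have "T (d + (real n * d + r)) = T d o\<^sub>L T (real n * d + r)"
      using assms d that unfolding C0_semigroup_def by simp
    then have "norm (T (real (Suc n) * d + r)) \<le> norm (T d) * norm (T (real n * d + r))"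
      using norm_blinfun_compose[of "T d" "T (real n * d + r)"] by (simp add: algebra_simps)
    also have "\<dots> \<le> M * (M * M ^ n)"
      by (intro mult_mono Suc M) (use d in auto)
    finally show ?case by simp
  qed
  \<comment> \<open>The exponent comes from writing \<open>M ^ n\<close> as
    \<open>exp (n * ln M)\<close> with \<open>n \<le> t / d\<close>; \<open>M \<ge> 1\<close> keeps
    \<open>ln M\<close> nonnegative.\<close>
  have "norm (T t) \<le> M * exp (ln M / d * t)" if t: "t \<ge> 0" for t
  proof -
    define n where "n = nat \<lfloor>t / d\<rfloor>"
    have n: "real n \<le> t / d" "t / d < real n + 1"
      unfolding n_def using t d by (auto simp: of_nat_nat)
    have "real n * d \<le> t" "t < real n * d + d"
      using n d by (auto simp: field_simps)
    then have "t - real n * d \<in> {0..d}" by auto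
    from *[OF this, of n] have "norm (T t) \<le> M * M ^ n" by simp
    also have "M ^ n = exp (real n * ln M)"
      using d by (simp add: exp_of_nat_mult)
    also have "\<dots> \<le> exp (t / d * ln M)"
      using n d by (intro iffD2[OF exp_le_cancel_iff] mult_right_mono) auto
    finally show ?thesis using d by (simp add: mult.commute)
  qed
  then show ?thesis using d by blast
qed

lemma C0_semigroup_bounded_on:
  fixes T :: "real \<Rightarrow> 'a::banach \<Rightarrow>\<^sub>L 'a"
  assumes "C0_semigroup T"
  shows "\<exists>M>0. \<forall>t\<in>{0..b}. norm (T t) \<le> M"
proof -
  obtain \<nu> M where M: "M \<ge> 1" "\<And>t. t \<ge> 0 \<Longrightarrow> norm (T t) \<le> M * exp (\<nu> * t)"
    using C0_semigroup_exponential_bound[OF assms] by metis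
  have "norm (T t) \<le> M * exp (\<bar>\<nu>\<bar> * b)" if "t \<in> {0..b}" for t
  proof -
    have "\<nu> * t \<le> \<bar>\<nu>\<bar> * b"
      using that by (smt (verit) atLeastAtMost_iff mult_mono abs_ge_self mult_right_mono)
    then have "M * exp (\<nu> * t) \<le> M * exp (\<bar>\<nu>\<bar> * b)" using M by simp
    then show ?thesis using M(2)[of t] that by auto
  qed
  moreover have "M * exp (\<bar>\<nu>\<bar> * b) > 0" using M by simp
  ultimately show ?thesis by blast
qed

lemma C0_semigroup_continuous_at_zero:
  assumes "C0_semigroup T" "e > 0"
  shows "\<exists>d>0. \<forall>h. 0 \<le> h \<and> h < d \<longrightarrow> norm (T h x - x) < e"
proof -
  have "((\<lambda>t. T t x) \<longlongrightarrow> x) (at_right 0)" using assms by (simp add: C0_semigroup_def)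
  then have "eventually (\<lambda>t. dist (T t x) x < e) (at_right 0)"
    using assms(2) tendstoD by blast
  then obtain d where "d > 0" "\<And>h. 0 < h \<Longrightarrow> h < d \<Longrightarrow> norm (T h x - x) < e"
    unfolding eventually_at_right_field by (auto simp: dist_norm)
  moreover have "norm (T 0 x - x) < e" using assms C0_semigroup_zero by force
  ultimately show ?thesis by (metis order_le_less)
qed

text \<open>Joint continuity is what convolution integrands require, since time and vector move
  together there. Only right continuity at zero is given; continuity from the left follows by
  factoring out the smaller of two times, whose operator is bounded locally.\<close>

lemma C0_semigroup_continuous_on:
  fixes T :: "real \<Rightarrow> 'a::banach \<Rightarrow>\<^sub>L 'a"
  assumes "C0_semigroup T"
  shows "continuous_on ({0..} \<times> UNIV) (\<lambda>(t, x). T t x)"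
  unfolding continuous_on_iff
proof (intro ballI allI impI)
  fix p :: "real \<times> 'a" and e :: real
  assume "p \<in> {0..} \<times> UNIV" and e: "e > 0"
  then obtain t x where p: "p = (t, x)" and t: "0 \<le> t" by auto
  obtain M where M: "M > 0" "\<And>s. s \<in> {0..t+1} \<Longrightarrow> norm (T s) \<le> M"
    using C0_semigroup_bounded_on[OF assms] by metis
  obtain d where d: "d > 0" "\<And>h. 0 \<le> h \<Longrightarrow> h < d \<Longrightarrow> norm (T h x - x) < e / (2 * M)"
    using C0_semigroup_continuous_at_zero[OF assms, of "e / (2 * M)" x] e M by auto
  have *: "norm (T s x - T r x) < e / 2" if "0 \<le> r" "r \<le> s" "s \<le> t + 1" "s - r < d" for r s
  proof -
    have "T s x = T r (T (s - r) x)"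
      using C0_semigroup_add[OF assms, of r "s - r" x] that by simp
    then have "norm (T s x - T r x) = norm (T r (T (s - r) x - x))"
      by (simp add: blinfun.diff_right)
    also have "\<dots> \<le> norm (T r) * norm (T (s - r) x - x)" by (rule norm_blinfun)
    also have "\<dots> \<le> M * norm (T (s - r) x - x)"
      using M(2)[of r] that by (intro mult_right_mono) auto
    also have "\<dots> < M * (e / (2 * M))"
      using d(2)[of "s - r"] that M by (intro mult_strict_left_mono) auto
    finally show ?thesis using M by simp
  qed
  define \<delta> where "\<delta> = min 1 (min d (e / (2 * M)))"
  have "\<delta> > 0" using d e M by (simp add: \<delta>_def)
  moreover have "dist (T s y) (T t x) < e" if s: "0 \<le> s" and close: "dist (s, y) (t, x) < \<delta>" for s y
  proof -
    have "dist s t < \<delta>" "dist y x < \<delta>"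
      using close dist_fst_le[of "(s, y)" "(t, x)"] dist_snd_le[of "(s, y)" "(t, x)"] by auto
    then have st: "\<bar>s - t\<bar> < 1" "\<bar>s - t\<bar> < d" "norm (y - x) < e / (2 * M)"
      by (auto simp: \<delta>_def dist_norm)
    have 1: "norm (T s x - T t x) < e / 2"
    proof (cases "s \<le> t")
      case True
      then show ?thesis using *[of s t] s t st by (simp add: norm_minus_commute)
    next
      case False
      then show ?thesis using *[of t s] s t st by simp
    qed
    have "norm (T s y - T s x) = norm (T s (y - x))" by (simp add: blinfun.diff_right)
    also have "\<dots> \<le> norm (T s) * norm (y - x)" by (rule norm_blinfun)
    also have "\<dots> \<le> M * norm (y - x)"
      using M(2)[of s] s st by (intro mult_right_mono) auto
    also have "\<dots> < M * (e / (2 * M))"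
      using st M by (intro mult_strict_left_mono) auto
    finally have 2: "norm (T s y - T s x) < e / 2" using M by simp
    show ?thesis
      using 1 2 norm_triangle_ineq[of "T s y - T s x" "T s x - T t x"] by (simp add: dist_norm)
  qed
  ultimately show "\<exists>d>0. \<forall>q\<in>{0..} \<times> UNIV. dist q p < d \<longrightarrow>
      dist (case q of (t, x) \<Rightarrow> T t x) (case p of (t, x) \<Rightarrow> T t x) < e"
    unfolding p by (intro exI[of _ \<delta>]) auto
qed

lemma C0_semigroup_continuous_on_compose:
  fixes T :: "real \<Rightarrow> 'a::banach \<Rightarrow>\<^sub>L 'a"
  assumes "C0_semigroup T" "continuous_on X p" "continuous_on X f" "\<And>x. x \<in> X \<Longrightarrow> 0 \<le> p x"
  shows "continuous_on X (\<lambda>x. T (p x) (f x))"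
proof -
  have "continuous_on X (\<lambda>x. (\<lambda>(t, y). T t y) (p x, f x))"
    by (rule continuous_on_compose2[OF C0_semigroup_continuous_on[OF assms(1)]])
      (use assms in \<open>auto intro!: continuous_intros\<close>)
  then show ?thesis by simp
qed

lemma continuous_on_convolution:
  fixes T :: "real \<Rightarrow> 'a::banach \<Rightarrow>\<^sub>L 'a"
  assumes "C0_semigroup T" "continuous_on UNIV f" "b \<le> t"
  shows "continuous_on {a..b} (\<lambda>r. T (t - r) (f r))"
  using assms by (intro C0_semigroup_continuous_on_compose continuous_intros)
    (auto intro: continuous_on_subset)

lemma integrable_convolution:
  fixes T :: "real \<Rightarrow> 'a::banach \<Rightarrow>\<^sub>L 'a"
  assumes "C0_semigroup T" "continuous_on UNIV f" "b \<le> t"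
  shows "(\<lambda>r. T (t - r) (f r)) integrable_on {a..b}"
  by (intro integrable_continuous_real continuous_on_convolution assms)

section \<open>Exponential damping\<close>

lemma damped_semigroup_apply:
  "damped_semigroup c T t x = exp (- c * t) *\<^sub>R T t x"
  by (simp add: damped_semigroup_def scaleR_blinfun.rep_eq)

lemma C0_semigroup_damped:
  fixes T :: "real \<Rightarrow> 'a::banach \<Rightarrow>\<^sub>L 'a"
  assumes "C0_semigroup T"
  shows "C0_semigroup (damped_semigroup c T)"
  unfolding C0_semigroup_def
proof (intro conjI allI impI)
  show "damped_semigroup c T 0 = id_blinfun"
    using assms by (simp add: damped_semigroup_def C0_semigroup_def)
  show "damped_semigroup c T (s + t) = damped_semigroup c T s o\<^sub>L damped_semigroup c T t"
    if "s \<ge> 0" "t \<ge> 0" for s t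
    using C0_semigroup_add[OF assms that]
    by (intro blinfun_eqI)
      (simp add: damped_semigroup_apply blinfun.scaleR_right ring_distribs exp_add exp_diff
        exp_minus divide_inverse mult.commute)
  show "((\<lambda>t. damped_semigroup c T t x) \<longlongrightarrow> x) (at_right 0)" for x
  proof -
    have "((\<lambda>t. exp (- c * t)) \<longlongrightarrow> exp (- c * 0)) (at_right 0)"
      by (intro tendsto_intros)
    then have "((\<lambda>t. exp (- c * t)) \<longlongrightarrow> 1) (at_right 0)" by simp
    from tendsto_scaleR[OF this] show ?thesis
      using assms unfolding damped_semigroup_apply C0_semigroup_def by fastforce
  qed
qed

section \<open>Mild solutions of linear equations\<close>

lemma C0_semigroup_tendsto:
  fixes T :: "real \<Rightarrow> 'a::banach \<Rightarrow>\<^sub>L 'a"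
  assumes "C0_semigroup T" "(p \<longlongrightarrow> t) F" "(f \<longlongrightarrow> x) F" "0 \<le> t" "eventually (\<lambda>s. 0 \<le> p s) F"
  shows "((\<lambda>s. T (p s) (f s)) \<longlongrightarrow> T t x) F"
proof -
  have "((\<lambda>s. (\<lambda>(t, y). T t y) (p s, f s)) \<longlongrightarrow> (\<lambda>(t, y). T t y) (t, x)) F"
    by (rule continuous_on_tendsto_compose[OF C0_semigroup_continuous_on[OF assms(1)]])
      (use assms in \<open>auto intro!: tendsto_intros\<close>)
  then show ?thesis by simp
qed

text \<open>The end \<open>b\<close> of the interval is kept apart from the evaluation time
  \<open>t\<close>, so that applying \<open>T h\<close> only advances \<open>t\<close> and pieces of
  the integral can be recombined.\<close>

definition duhamel ::
    "(real \<Rightarrow> 'a::banach \<Rightarrow>\<^sub>L 'a) \<Rightarrow> (real \<Rightarrow> 'a) \<Rightarrow> real \<Rightarrow> real \<Rightarrow> real \<Rightarrow> 'a" where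
  "duhamel T f a b t = integral {a..b} (\<lambda>r. T (t - r) (f r))"

text \<open>There is no initial time: the formula is required between all pairs of times on the
  line. The nonlinear notion is the case in which \<open>f\<close> is the right-hand side evaluated
  along \<open>u\<close>.\<close>

definition linear_mild_solution ::
    "(real \<Rightarrow> 'a::banach \<Rightarrow>\<^sub>L 'a) \<Rightarrow> (real \<Rightarrow> 'a) \<Rightarrow> (real \<Rightarrow> 'a) \<Rightarrow> bool" where
  "linear_mild_solution T f u \<longleftrightarrow> (\<forall>s t. s \<le> t \<longrightarrow> u t = T (t - s) (u s) + duhamel T f s t t)"

lemma duhamel_combine:
  assumes "C0_semigroup T" "continuous_on UNIV f" "a \<le> b" "b \<le> c" "c \<le> t"
  shows "duhamel T f a b t + duhamel T f b c t = duhamel T f a c t"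
  unfolding duhamel_def
  using assms by (intro Henstock_Kurzweil_Integration.integral_combine integrable_convolution) auto

lemma semigroup_duhamel:
  assumes "C0_semigroup T" "continuous_on UNIV f" "b \<le> t" "0 \<le> h"
  shows "T h (duhamel T f a b t) = duhamel T f a b (t + h)"
proof -
  have "T h (duhamel T f a b t) = integral {a..b} (blinfun_apply (T h) \<circ> (\<lambda>r. T (t - r) (f r)))"
    unfolding duhamel_def
    by (intro integral_linear[symmetric] integrable_convolution assms blinfun.bounded_linear_right)
  also have "\<dots> = duhamel T f a b (t + h)"
    unfolding duhamel_def
  proof (rule Henstock_Kurzweil_Integration.integral_cong)
    fix r assume "r \<in> {a..b}"
    then show "(blinfun_apply (T h) \<circ> (\<lambda>r. T (t - r) (f r))) r = T (t + h - r) (f r)"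
      using C0_semigroup_add[OF assms(1), of h "t - r" "f r"] assms
      by (simp add: algebra_simps)
  qed
  finally show ?thesis .
qed

lemma duhamel_shift:
  assumes "\<And>t. f (t + \<omega>) = f t"
  shows "duhamel T f (a + \<omega>) (b + \<omega>) (t + \<omega>) = duhamel T f a b t"
  using integral_shift_Icc_real[of a b "\<lambda>r. T (t + \<omega> - r) (f r)" \<omega>] assms
  by (simp add: duhamel_def o_def add.commute[of \<omega>])

lemma norm_duhamel_le:
  assumes "C0_semigroup T" "continuous_on UNIV f" "a \<le> b" "b \<le> t"
    and "\<And>r. 0 \<le> r \<Longrightarrow> norm (T r) \<le> M" "\<And>r. norm (f r) \<le> G"
  shows "norm (duhamel T f a b t) \<le> M * G * (b - a)"
  unfolding duhamel_def
proof (rule integral_bound[OF \<open>a \<le> b\<close> continuous_on_convolution[OF assms(1,2,4)]])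
  fix r assume r: "r \<in> {a..b}"
  have "norm (T (t - r) (f r)) \<le> norm (T (t - r)) * norm (f r)" by (rule norm_blinfun)
  also have "\<dots> \<le> M * G"
    using assms(5)[of "t - r"] assms(6)[of r] r assms(4) order_trans[OF norm_ge_zero assms(5)[of "t - r"]]
    by (intro mult_mono) auto
  finally show "norm (T (t - r) (f r)) \<le> M * G" .
qed

text \<open>For \<open>f\<close> and \<open>u\<close> related by the variation of constants formula,
  \<open>r \<mapsto> T (t - r) (u r)\<close> has derivative \<open>T (t - r) (f r)\<close>, although neither factor is
  differentiable; multiplying by \<open>exp (- c * (t - r))\<close> and integrating gives the claim.\<close>

lemma linear_mild_solution_damped:
  fixes T :: "real \<Rightarrow> 'a::banach \<Rightarrow>\<^sub>L 'a"
  assumes T: "C0_semigroup T" and f: "continuous_on UNIV f" and u: "linear_mild_solution T f u"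
  shows "linear_mild_solution (damped_semigroup c T) (\<lambda>r. f r + c *\<^sub>R u r) u"
  unfolding linear_mild_solution_def
proof (intro allI impI)
  fix s t :: real assume st: "s \<le> t"
  define g where "g r = T (t - r) (u r)" for r
  define h where "h q = T (t - q) (f q)" for q
  have h: "continuous_on {s..t} h"
    unfolding h_def by (intro continuous_on_convolution T f order_refl)
  \<comment> \<open>The mild formula from \<open>r\<close> to \<open>t\<close> exhibits
    \<open>g\<close> as a constant plus the indefinite integral of a continuous function; this is
    where its derivative comes from.\<close>
  have g_eq: "g r = (u t - integral {s..t} h) + integral {s..r} h" if r: "r \<in> {s..t}" for r
  proof -
    have "u t = g r + duhamel T f r t t"
      using u r unfolding linear_mild_solution_def g_def by auto
    moreover have "duhamel T f s r t + duhamel T f r t t = duhamel T f s t t"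
      using r by (intro duhamel_combine T f) auto
    ultimately show ?thesis by (simp add: duhamel_def h_def[abs_def] algebra_simps)
  qed
  have "((\<lambda>r. exp (- c * (t - r)) *\<^sub>R g r) has_vector_derivative
      damped_semigroup c T (t - r) (f r + c *\<^sub>R u r)) (at r within {s..t})"
    if r: "r \<in> {s..t}" for r
  proof -
    have "((\<lambda>r. (u t - integral {s..t} h) + integral {s..r} h) has_vector_derivative 0 + h r)
        (at r within {s..t})"
      by (intro has_vector_derivative_add has_vector_derivative_const
          integral_has_vector_derivative h r)
    from has_vector_derivative_transform[OF r g_eq this]
    have g: "(g has_vector_derivative h r) (at r within {s..t})" by simp
    have "((\<lambda>r. exp (- c * (t - r))) has_field_derivative exp (- c * (t - r)) * c)
        (at r within {s..t})"
      by (auto intro!: derivative_eq_intros)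
    from has_vector_derivative_scaleR[OF this g] show ?thesis
      by (simp add: damped_semigroup_apply h_def g_def blinfun.bilinear_simps algebra_simps)
  qed
  then have "((\<lambda>r. damped_semigroup c T (t - r) (f r + c *\<^sub>R u r)) has_integral
      exp (- c * (t - t)) *\<^sub>R g t - exp (- c * (t - s)) *\<^sub>R g s) {s..t}"
    by (intro fundamental_theorem_of_calculus st)
  then have "duhamel (damped_semigroup c T) (\<lambda>r. f r + c *\<^sub>R u r) s t t =
      g t - exp (- c * (t - s)) *\<^sub>R g s"
    unfolding duhamel_def by (simp add: integral_unique)
  then show "u t = damped_semigroup c T (t - s) (u s) +
      duhamel (damped_semigroup c T) (\<lambda>r. f r + c *\<^sub>R u r) s t t"
    using C0_semigroup_zero[OF T] by (simp add: g_def damped_semigroup_apply)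
qed

text \<open>Damping by \<open>- c\<close> undoes damping by \<open>c\<close>, so the converse is
  another instance of the same implication.\<close>

lemma linear_mild_solution_damped_iff:
  fixes T :: "real \<Rightarrow> 'a::banach \<Rightarrow>\<^sub>L 'a"
  assumes T: "C0_semigroup T" and f: "continuous_on UNIV f" and u: "continuous_on UNIV u"
  shows "linear_mild_solution (damped_semigroup c T) (\<lambda>r. f r + c *\<^sub>R u r) u \<longleftrightarrow>
    linear_mild_solution T f u"
proof
  assume "linear_mild_solution (damped_semigroup c T) (\<lambda>r. f r + c *\<^sub>R u r) u"
  then have "linear_mild_solution (damped_semigroup (- c) (damped_semigroup c T))
      (\<lambda>r. (f r + c *\<^sub>R u r) + (- c) *\<^sub>R u r) u"
    by (rule linear_mild_solution_damped[OF C0_semigroup_damped[OF T], rotated])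
      (intro continuous_intros f u)
  moreover have "(\<lambda>r. (f r + c *\<^sub>R u r) + (- c) *\<^sub>R u r) = f"
    by (simp add: fun_eq_iff)
  moreover have "damped_semigroup (- c) (damped_semigroup c T) = T"
    by (rule ext) (simp add: damped_semigroup_def flip: exp_add)
  ultimately show "linear_mild_solution T f u" by simp
qed (use linear_mild_solution_damped[OF T f] in blast)

section \<open>Differentiable orbits and strict solutions\<close>

lemma has_vector_derivative_iff_tendsto:
  "(f has_vector_derivative y) (at x within S) \<longleftrightarrow>
    ((\<lambda>z. (f z - f x) /\<^sub>R (z - x)) \<longlongrightarrow> y) (at x within S)"
proof -
  have "(f has_vector_derivative y) (at x within S) \<longleftrightarrow>
      ((\<lambda>z. (f z - f x - (z - x) *\<^sub>R y) /\<^sub>R norm (z - x)) \<longlongrightarrow> 0) (at x within S)"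
    by (simp add: has_vector_derivative_def has_derivative_at_within bounded_linear_scaleR_left)
  also have "\<dots> \<longleftrightarrow> ((\<lambda>z. norm ((f z - f x - (z - x) *\<^sub>R y) /\<^sub>R norm (z - x))) \<longlongrightarrow> 0) (at x within S)"
    by (rule tendsto_norm_zero_iff[symmetric])
  also have "\<dots> \<longleftrightarrow> ((\<lambda>z. norm ((f z - f x) /\<^sub>R (z - x) - y)) \<longlongrightarrow> 0) (at x within S)"
  proof (rule tendsto_cong)
    have "norm ((f z - f x - (z - x) *\<^sub>R y) /\<^sub>R norm (z - x)) = norm ((f z - f x) /\<^sub>R (z - x) - y)"
      if "z \<noteq> x" for z
    proof -
      have "(f z - f x) /\<^sub>R (z - x) - y = (f z - f x - (z - x) *\<^sub>R y) /\<^sub>R (z - x)"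
        using that by (simp add: scaleR_diff_right)
      then show ?thesis by simp
    qed
    then show "\<forall>\<^sub>F z in at x within S. norm ((f z - f x - (z - x) *\<^sub>R y) /\<^sub>R norm (z - x)) =
        norm ((f z - f x) /\<^sub>R (z - x) - y)"
      by (auto simp: eventually_at_filter)
  qed
  also have "\<dots> \<longleftrightarrow> ((\<lambda>z. (f z - f x) /\<^sub>R (z - x)) \<longlongrightarrow> y) (at x within S)"
    by (subst tendsto_norm_zero_iff) (rule LIM_zero_iff)
  finally show ?thesis .
qed

text \<open>The generator supplies a right-hand limit at zero only. For \<open>s\<close> on either
  side of \<open>t\<close> the difference quotient equals \<open>T (min s t)\<close> applied to the
  generator quotient with step \<open>\<bar>s - t\<bar>\<close>, so joint continuity of the
  semigroup gives the two-sided derivative.\<close>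

lemma generates_orbit_derivative:
  fixes T :: "real \<Rightarrow> 'a::banach \<Rightarrow>\<^sub>L 'a"
  assumes T: "C0_semigroup T" and gen: "generates D B T" and x: "x \<in> D" and t: "0 \<le> t"
  shows "((\<lambda>t. T t x) has_vector_derivative T t (B x)) (at t within {0..})"
  unfolding has_vector_derivative_iff_tendsto
proof -
  have B: "((\<lambda>h. (1 / h) *\<^sub>R (T h x - x)) \<longlongrightarrow> B x) (at_right 0)"
    using gen x by (simp add: generates_def)
  have "((\<lambda>s. \<bar>s - t\<bar>) \<longlongrightarrow> \<bar>t - t\<bar>) (at t within {0..})"
    by (intro tendsto_intros)
  then have h: "filterlim (\<lambda>s. \<bar>s - t\<bar>) (at_right 0) (at t within {0..})"
    by (auto simp: filterlim_at eventually_at_filter)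
  have "((\<lambda>s. min s t) \<longlongrightarrow> min t t) (at t within {0..})"
    by (intro tendsto_intros)
  then have "((\<lambda>s. T (min s t) ((1 / \<bar>s - t\<bar>) *\<^sub>R (T \<bar>s - t\<bar> x - x))) \<longlongrightarrow> T t (B x)) (at t within {0..})"
    by (intro C0_semigroup_tendsto T filterlim_compose[OF B h])
      (use t in \<open>auto simp: eventually_at_filter\<close>)
  moreover have "T (min s t) ((1 / \<bar>s - t\<bar>) *\<^sub>R (T \<bar>s - t\<bar> x - x)) = (T s x - T t x) /\<^sub>R (s - t)"
    if s: "0 \<le> s" "s \<noteq> t" for s
  proof (cases "s < t")
    case True
    then have "T t x = T s (T (t - s) x)"
      using C0_semigroup_add[OF T, of s "t - s" x] s by simp
    then have "T (min s t) ((1 / \<bar>s - t\<bar>) *\<^sub>R (T \<bar>s - t\<bar> x - x)) = (1 / (t - s)) *\<^sub>R (T t x - T s x)"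
      using True by (simp add: blinfun.bilinear_simps)
    also have "\<dots> = (T s x - T t x) /\<^sub>R (s - t)"
    proof -
      have "inverse (s - t) = - (1 / (t - s))"
        by (metis inverse_eq_divide minus_diff_eq minus_divide_right)
      then show ?thesis by (simp add: scaleR_diff_right)
    qed
    finally show ?thesis .
  next
    case False
    then have "T s x = T t (T (s - t) x)"
      using C0_semigroup_add[OF T, of t "s - t" x] t by simp
    then show ?thesis using False by (simp add: blinfun.bilinear_simps inverse_eq_divide)
  qed
  ultimately show "((\<lambda>s. (T s x - T t x) /\<^sub>R (s - t)) \<longlongrightarrow> T t (B x)) (at t within {0..})"
    by (elim Lim_transform_eventually) (auto simp: eventually_at_filter)
qed

text \<open>A product rule for \<open>T (t - r) (v r)\<close>, integrated over
  \<open>{s..t}\<close>. The difference quotient is split so that the increment of \<open>v\<close>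
  sits under a moving operator, handled by joint continuity, while the increment of the operator
  acts on the fixed vector \<open>v r\<close> of the domain, handled by the orbit
  derivative.\<close>

lemma strict_solution_imp_linear_mild_solution:
  fixes T :: "real \<Rightarrow> 'a::banach \<Rightarrow>\<^sub>L 'a"
  assumes T: "C0_semigroup T" and gen: "generates D B T" and D: "\<And>t. v t \<in> D"
    and v: "\<And>t. (v has_vector_derivative v' t) (at t)"
  shows "linear_mild_solution T (\<lambda>t. v' t - B (v t)) v"
  unfolding linear_mild_solution_def
proof (intro allI impI)
  fix s t :: real assume st: "s \<le> t"
  have "((\<lambda>r. T (t - r) (v r)) has_vector_derivative T (t - r) (v' r - B (v r))) (at r within {s..t})"
    if r: "r \<in> {s..t}" for r
  proof -
    have "((\<lambda>q. t - q) has_vector_derivative (- 1)) (at r within {s..t})"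
      by (auto intro!: derivative_eq_intros)
    moreover have "((\<lambda>q. T q (v r)) has_vector_derivative T (t - r) (B (v r)))
        (at (t - r) within (\<lambda>q. t - q) ` {s..t})"
      using r by (intro has_vector_derivative_within_subset[OF generates_orbit_derivative[OF T gen D]])
        auto
    ultimately have "((\<lambda>q. T q (v r)) \<circ> (\<lambda>q. t - q) has_vector_derivative (- 1) *\<^sub>R T (t - r) (B (v r)))
        (at r within {s..t})"
      by (rule vector_diff_chain_within)
    then have 1: "((\<lambda>q. (T (t - q) (v r) - T (t - r) (v r)) /\<^sub>R (q - r)) \<longlongrightarrow> - T (t - r) (B (v r)))
        (at r within {s..t})"
      unfolding has_vector_derivative_iff_tendsto by (simp add: o_def)
    have "((\<lambda>q. (v q - v r) /\<^sub>R (q - r)) \<longlongrightarrow> v' r) (at r within {s..t})"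
      using has_vector_derivative_at_within[OF v]
      unfolding has_vector_derivative_iff_tendsto .
    then have 2: "((\<lambda>q. T (t - q) ((v q - v r) /\<^sub>R (q - r))) \<longlongrightarrow> T (t - r) (v' r)) (at r within {s..t})"
      using r by (intro C0_semigroup_tendsto T tendsto_intros) (auto simp: eventually_at_filter)
    have "(T (t - q) (v q) - T (t - r) (v r)) /\<^sub>R (q - r) =
        T (t - q) ((v q - v r) /\<^sub>R (q - r)) + (T (t - q) (v r) - T (t - r) (v r)) /\<^sub>R (q - r)" for q
      by (simp add: blinfun.bilinear_simps algebra_simps)
    then show ?thesis
      using tendsto_add[OF 2 1] unfolding has_vector_derivative_iff_tendsto
      by (simp add: blinfun.bilinear_simps)
  qed
  then have "((\<lambda>r. T (t - r) (v' r - B (v r))) has_integral T (t - t) (v t) - T (t - s) (v s)) {s..t}"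
    by (intro fundamental_theorem_of_calculus st)
  then show "v t = T (t - s) (v s) + duhamel T (\<lambda>t. v' t - B (v t)) s t t"
    using C0_semigroup_zero[OF T] by (simp add: duhamel_def integral_unique)
qed

text \<open>Riemann sums are nonnegative combinations of values of \<open>f\<close>, hence in the
  cone, and closedness carries this over to their limit.\<close>

lemma integral_nonneg_closed_cone:
  fixes f :: "real \<Rightarrow> 'a::{banach, ordered_real_vector}"
  assumes "closed (positive_cone :: 'a set)" "f integrable_on {a..b}"
    and "\<And>x. x \<in> {a..b} \<Longrightarrow> 0 \<le> f x"
  shows "0 \<le> integral {a..b} f"
proof -
  have "((\<lambda>p. \<Sum>(x, k)\<in>p. measure lborel k *\<^sub>R f x) \<longlongrightarrow> integral {a..b} f) (division_filter (cbox a b))"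
    using integrable_integral[OF assms(2)] unfolding has_integral_cbox[symmetric] by simp
  moreover have "\<forall>\<^sub>F p in division_filter (cbox a b). (\<Sum>(x, k)\<in>p. measure lborel k *\<^sub>R f x) \<in> positive_cone"
    using eventually_division_filter_tagged_division[of "cbox a b"]
  proof eventually_elim
    case (elim p)
    have "0 \<le> (case q of (x, k) \<Rightarrow> measure lborel k *\<^sub>R f x)" if "q \<in> p" for q
    proof (cases q)
      case (Pair x k)
      with that have "x \<in> {a..b}" using tag_in_interval[OF elim] by auto
      then show ?thesis using assms(3) by (simp add: Pair scaleR_nonneg_nonneg)
    qed
    then show ?case by (simp add: positive_cone_def sum_nonneg)
  qed
  ultimately have "integral {a..b} f \<in> positive_cone"
    by (intro Lim_in_closed_set[OF assms(1) _ division_filter_not_empty])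
  then show ?thesis by (simp add: positive_cone_def)
qed

section \<open>The linear periodic problem for an exponentially stable semigroup\<close>

locale stable_semigroup =
  fixes S :: "real \<Rightarrow> 'a::banach \<Rightarrow>\<^sub>L 'a" and M \<delta> \<omega> :: real
  assumes C0: "C0_semigroup S"
    and stable: "0 \<le> t \<Longrightarrow> norm (S t) \<le> M * exp (- \<delta> * t)"
    and \<delta>: "\<delta> > 0" and M: "M \<ge> 1" and \<omega>: "\<omega> > 0"
begin

text \<open>This is the Neumann series of \<open>(I - S \<omega>)\<close>, with the powers of
  \<open>S \<omega>\<close> written as \<open>S (n \<omega>)\<close>. As \<open>M\<close> may be
  large, the norm of \<open>S \<omega>\<close> need not be below 1; convergence comes from the
  exponential decay of the terms.\<close>

definition R :: "'a \<Rightarrow>\<^sub>L 'a" where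
  "R = (\<Sum>n. S (real n * \<omega>))"

text \<open>The mild formula over one period together with \<open>u (t - \<omega>) = u t\<close>
  reads \<open>u t - S \<omega> (u t) = duhamel S f (t - \<omega>) t t\<close>; solving for
  \<open>u t\<close> gives this expression.\<close>

definition periodic_solution :: "(real \<Rightarrow> 'a) \<Rightarrow> real \<Rightarrow> 'a" where
  "periodic_solution f t = R (duhamel S f (t - \<omega>) t t)"

lemma norm_le_M: "0 \<le> t \<Longrightarrow> norm (S t) \<le> M"
proof -
  assume t: "0 \<le> t"
  have "M * exp (- \<delta> * t) \<le> M * 1" using t \<delta> M by (intro mult_left_mono) auto
  with stable[OF t] show ?thesis by simp
qed

lemma R_sums: "(\<lambda>n. S (real n * \<omega>)) sums R"
proof -
  have q: "norm (exp (- \<delta> * \<omega>)) < 1" using \<delta> \<omega> by simp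
  have "norm (S (real n * \<omega>)) \<le> M * exp (- \<delta> * \<omega>) ^ n" for n
  proof -
    have "- \<delta> * (real n * \<omega>) = real n * (- \<delta> * \<omega>)" by simp
    then show ?thesis
      using stable[of "real n * \<omega>"] \<omega> by (metis exp_of_nat_mult less_imp_le of_nat_0_le_iff zero_le_mult_iff)
  qed
  moreover have "summable (\<lambda>n. M * exp (- \<delta> * \<omega>) ^ n)"
    by (intro summable_mult summable_geometric q)
  ultimately have "summable (\<lambda>n. S (real n * \<omega>))"
    by (metis summable_comparison_test')
  then show ?thesis unfolding R_def by (rule summable_sums)
qed

lemma telescoping_sums: "(\<lambda>n. S (real n * \<omega>) - S (real (Suc n) * \<omega>)) sums id_blinfun"
  using telescope_sums'[OF summable_LIMSEQ_zero[OF sums_summable[OF R_sums]]] C0_semigroup_zero[OF C0]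
  by simp

lemma R_left: "R (x - S \<omega> x) = x"
proof -
  have "S (real n * \<omega>) (x - S \<omega> x) = (S (real n * \<omega>) - S (real (Suc n) * \<omega>)) x" for n
    using C0_semigroup_add[OF C0, of "real n * \<omega>" \<omega> x] \<omega>
    by (simp add: blinfun.diff_left blinfun.diff_right distrib_right add.commute)
  then have "(\<lambda>n. (S (real n * \<omega>) - S (real (Suc n) * \<omega>)) x) sums R (x - S \<omega> x)"
    using bounded_linear.sums[OF blinfun.bounded_linear_left R_sums, of "x - S \<omega> x"] by simp
  moreover have "(\<lambda>n. (S (real n * \<omega>) - S (real (Suc n) * \<omega>)) x) sums id_blinfun x"
    by (rule bounded_linear.sums[OF blinfun.bounded_linear_left telescoping_sums])
  ultimately show ?thesis using sums_unique2 by fastforce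
qed

lemma R_right: "R x - S \<omega> (R x) = x"
proof -
  have "S \<omega> (S (real n * \<omega>) x) = S (real (Suc n) * \<omega>) x" for n
    using C0_semigroup_add[OF C0, of \<omega> "real n * \<omega>" x] \<omega> by (simp add: distrib_right)
  then have "(\<lambda>n. S (real (Suc n) * \<omega>) x) sums S \<omega> (R x)"
    using bounded_linear.sums[OF blinfun.bounded_linear_right, OF
        bounded_linear.sums[OF blinfun.bounded_linear_left R_sums], of "S \<omega>" x] by simp
  from sums_diff[OF bounded_linear.sums[OF blinfun.bounded_linear_left R_sums] this]
  have "(\<lambda>n. (S (real n * \<omega>) - S (real (Suc n) * \<omega>)) x) sums (R x - S \<omega> (R x))"
    by (simp add: blinfun.bilinear_simps)
  moreover have "(\<lambda>n. (S (real n * \<omega>) - S (real (Suc n) * \<omega>)) x) sums id_blinfun x"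
    by (rule bounded_linear.sums[OF blinfun.bounded_linear_left telescoping_sums])
  ultimately show ?thesis using sums_unique2 by fastforce
qed

text \<open>This links the set-theoretic inverse in \<open>iteration_operator\<close> with the
  bounded operator \<open>R\<close>, whose series form shows positivity.\<close>

lemma inv_id_minus: "inv (blinfun_apply (id_blinfun - S \<omega>)) = R"
proof (rule inv_equality)
  show "R ((id_blinfun - S \<omega>) x) = x" for x using R_left[of x] by (simp add: blinfun.diff_left)
  show "(id_blinfun - S \<omega>) (R x) = x" for x using R_right[of x] by (simp add: blinfun.diff_left)
qed

lemma periodic_solution_periodic:
  assumes "\<And>t. f (t + \<omega>) = f t"
  shows "periodic_solution f (t + \<omega>) = periodic_solution f t"
  using duhamel_shift[where f=f and \<omega>=\<omega>, OF assms, of S "t - \<omega>" t t] by (simp add: periodic_solution_def)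

text \<open>\<open>I - S \<omega>\<close> is injective with left inverse \<open>R\<close>, so it
  suffices to apply it to the right-hand side \<open>z\<close> of the mild formula and to recover
  the integral over the last period before \<open>t\<close>.\<close>

lemma periodic_solution_mild:
  assumes f: "continuous_on UNIV f" and per: "\<And>t. f (t + \<omega>) = f t"
  shows "linear_mild_solution S f (periodic_solution f)"
  unfolding linear_mild_solution_def
proof (intro allI impI)
  fix s t :: real assume st: "s \<le> t"
  define z where "z = S (t - s) (periodic_solution f s) + duhamel S f s t t"
  have "S \<omega> (S (t - s) x) = S (t - s) (S \<omega> x)" for x
    using C0_semigroup_add[OF C0, of \<omega> "t - s" x] C0_semigroup_add[OF C0, of "t - s" \<omega> x] \<omega> st
    by (simp add: add.commute)
  then have "z - S \<omega> z = S (t - s) (periodic_solution f s - S \<omega> (periodic_solution f s)) +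
      (duhamel S f s t t - S \<omega> (duhamel S f s t t))"
    by (simp add: z_def blinfun.bilinear_simps)
  also have "S (t - s) (periodic_solution f s - S \<omega> (periodic_solution f s)) = duhamel S f (s - \<omega>) s t"
    using semigroup_duhamel[OF C0 f, of s s "t - s" "s - \<omega>"] st
    by (simp add: periodic_solution_def R_right)
  also have "S \<omega> (duhamel S f s t t) = duhamel S f (s - \<omega>) (t - \<omega>) t"
    using semigroup_duhamel[OF C0 f, of t t \<omega> s] \<omega> duhamel_shift[where f=f and \<omega>=\<omega>, OF per, of S "s - \<omega>" "t - \<omega>" t]
    by simp
  \<comment> \<open>Both sides are compared through the integral over
    \<open>{s - \<omega>..t}\<close>, so it does not matter whether \<open>t - s\<close> exceeds the
    period.\<close>
  also have "duhamel S f (s - \<omega>) s t + (duhamel S f s t t - duhamel S f (s - \<omega>) (t - \<omega>) t) =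
      duhamel S f (t - \<omega>) t t"
    using duhamel_combine[OF C0 f, of "s - \<omega>" s t t] st \<omega>
      duhamel_combine[OF C0 f, of "s - \<omega>" "t - \<omega>" t t] by (simp add: algebra_simps)
  finally have "R (z - S \<omega> z) = periodic_solution f t"
    by (simp add: periodic_solution_def)
  then show "periodic_solution f t = S (t - s) (periodic_solution f s) + duhamel S f s t t"
    by (simp add: R_left z_def)
qed

lemma periodic_solution_unique:
  assumes "linear_mild_solution S f u" "\<And>t. u (t + \<omega>) = u t"
  shows "u = periodic_solution f"
proof
  fix t
  have "u t = S (t - (t - \<omega>)) (u (t - \<omega>)) + duhamel S f (t - \<omega>) t t"
    using assms(1) \<omega> unfolding linear_mild_solution_def by (metis diff_le_eq le_add_same_cancel1 less_imp_le)
  moreover have "u (t - \<omega>) = u t" using assms(2)[of "t - \<omega>"] by simp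
  ultimately have "duhamel S f (t - \<omega>) t t = u t - S \<omega> (u t)" by (simp add: algebra_simps)
  then show "u t = periodic_solution f t" by (simp add: periodic_solution_def R_left)
qed

end

section \<open>Compactness and equicontinuity of periodic solutions\<close>

lemma tendsto_le_closed_cone:
  fixes f g :: "'b \<Rightarrow> 'a::{real_normed_vector, ordered_real_vector}"
  assumes "closed (positive_cone :: 'a set)" "(f \<longlongrightarrow> a) F" "(g \<longlongrightarrow> b) F"
    and "\<forall>\<^sub>F x in F. f x \<le> g x" "F \<noteq> bot"
  shows "a \<le> b"
proof -
  have "\<forall>\<^sub>F x in F. g x - f x \<in> positive_cone"
    using assms(4) by eventually_elim (simp add: positive_cone_def)
  then have "b - a \<in> positive_cone"
    by (rule Lim_in_closed_set[OF assms(1) _ assms(5) tendsto_diff[OF assms(3,2)]])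
  then show ?thesis by (simp add: positive_cone_def)
qed

lemma normal_cone_bound:
  assumes "normal_cone (positive_cone :: 'a::{real_normed_vector, ordered_real_vector} set)"
  obtains N where "N > 0" "\<And>x y :: 'a. 0 \<le> x \<Longrightarrow> x \<le> y \<Longrightarrow> norm x \<le> N * norm y"
proof -
  obtain N where N: "\<And>x y :: 'a. 0 \<le> x \<Longrightarrow> x \<le> y \<Longrightarrow> norm x \<le> N * norm y"
    using assms unfolding normal_cone_def positive_cone_def by auto
  have "norm x \<le> max 1 N * norm y" if "0 \<le> x" "x \<le> y" for x y :: 'a
    using N[OF that] by (smt (verit) mult_right_mono norm_ge_zero)
  then show ?thesis using that[of "max 1 N"] by simp
qed

text \<open>Compactness gives a convergent subsequence, and closedness of the cone makes its limit
  \<open>l\<close> an upper bound of the whole sequence. For \<open>n \<ge> r m\<close> this yields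
  \<open>0 \<le> l - x n \<le> l - x (r m)\<close>, and normality turns one close subsequence member
  into closeness of all later members.\<close>

lemma increasing_in_compact_converges:
  fixes x :: "nat \<Rightarrow> 'a::{real_normed_vector, ordered_real_vector}"
  assumes cl: "closed (positive_cone :: 'a set)" and nc: "normal_cone (positive_cone :: 'a set)"
    and K: "compact K" "\<And>n. x n \<in> K" and inc: "\<And>n. x n \<le> x (Suc n)"
  shows "\<exists>l. x \<longlonglongrightarrow> l"
proof -
  obtain N where N: "N > 0" "\<And>x y :: 'a. 0 \<le> x \<Longrightarrow> x \<le> y \<Longrightarrow> norm x \<le> N * norm y"
    using normal_cone_bound[OF nc] by metis
  obtain l r where r: "strict_mono r" and l: "(x \<circ> r) \<longlonglongrightarrow> l"
    using K unfolding compact_def by blast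
  have mono: "x m \<le> x n" if "m \<le> n" for m n
    by (rule lift_Suc_mono_le[of x, OF inc that])
  have le: "x n \<le> l" for n
  proof (rule tendsto_le_closed_cone[OF cl tendsto_const l])
    show "\<forall>\<^sub>F m in sequentially. x n \<le> (x \<circ> r) m"
      using eventually_ge_at_top[of n]
      by eventually_elim (use mono seq_suble[OF r] in \<open>auto intro: order_trans\<close>)
  qed simp
  have "x \<longlonglongrightarrow> l"
  proof (rule LIMSEQ_I)
    fix e :: real assume e: "0 < e"
    then obtain m where m: "norm ((x \<circ> r) m - l) < e / N"
      using LIMSEQ_D[OF l, of "e / N"] N by (metis divide_pos_pos order_refl)
    have "norm (x n - l) < e" if "n \<ge> r m" for n
    proof -
      have "norm (l - x n) \<le> N * norm (l - x (r m))"
        using le[of n] mono[OF that] by (intro N(2)) (auto intro: diff_left_mono)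
      also have "\<dots> < N * (e / N)"
        using m N by (intro mult_strict_left_mono) (auto simp: norm_minus_commute)
      finally show ?thesis using N by (simp add: norm_minus_commute)
    qed
    then show "\<exists>no. \<forall>n\<ge>no. norm (x n - l) < e" by blast
  qed
  then show ?thesis by blast
qed

lemma monotone_in_compact_converges:
  fixes x :: "nat \<Rightarrow> 'a::{real_normed_vector, ordered_real_vector}"
  assumes cl: "closed (positive_cone :: 'a set)" and nc: "normal_cone (positive_cone :: 'a set)"
    and K: "compact K" "\<And>n. x n \<in> K"
    and mono: "(\<forall>n. x n \<le> x (Suc n)) \<or> (\<forall>n. x (Suc n) \<le> x n)"
  shows "\<exists>l. x \<longlonglongrightarrow> l"
  using mono
proof
  assume "\<forall>n. x (Suc n) \<le> x n"
  then have "\<exists>l. (\<lambda>n. - x n) \<longlonglongrightarrow> l"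
    using K by (intro increasing_in_compact_converges[OF cl nc compact_negations[OF K(1)]]) auto
  then show ?thesis using tendsto_minus_cancel_left by blast
next
  assume "\<forall>n. x n \<le> x (Suc n)"
  then show ?thesis
    by (intro increasing_in_compact_converges[where x=x, OF cl nc K]) auto
qed

text \<open>A finite net reduces uniform closeness to finitely many pointwise limits, and
  equicontinuity, inherited by the limit, covers the gaps. The net may leave \<open>X\<close>, so
  equicontinuity and convergence are asked for on the whole space.\<close>

lemma equicontinuous_pointwise_imp_uniform_limit:
  fixes v :: "nat \<Rightarrow> 'b::metric_space \<Rightarrow> 'a::metric_space"
  assumes X: "compact X"
    and eq: "\<And>e. e > 0 \<Longrightarrow> \<exists>d>0. \<forall>n s t. dist s t < d \<longrightarrow> dist (v n s) (v n t) < e"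
    and lim: "\<And>t. (\<lambda>n. v n t) \<longlonglongrightarrow> u t"
  shows "uniform_limit X v u sequentially"
proof (rule uniform_limitI)
  fix e :: real assume e: "0 < e"
  obtain d where d: "d > 0" and close: "\<And>n s t. dist s t < d \<Longrightarrow> dist (v n s) (v n t) < e / 4"
    using eq[of "e / 4"] e by auto
  have lim_close: "dist (u s) (u t) \<le> e / 4" if "dist s t < d" for s t
    by (rule tendsto_upperbound[OF tendsto_dist[OF lim lim]])
      (use close[OF that] in \<open>auto intro!: always_eventually less_imp_le\<close>)
  obtain k where k: "finite k" "X \<subseteq> (\<Union>x\<in>k. ball x d)"
    using X d unfolding compact_eq_totally_bounded by blast
  have "\<forall>\<^sub>F n in sequentially. \<forall>x\<in>k. dist (v n x) (u x) < e / 4"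
    using k(1) by (rule eventually_ball_finite) (intro ballI tendstoD[OF lim], simp add: e)
  then show "\<forall>\<^sub>F n in sequentially. \<forall>t\<in>X. dist (v n t) (u t) < e"
  proof eventually_elim
    case (elim n)
    show ?case
    proof
      fix t assume "t \<in> X"
      then obtain x where x: "x \<in> k" "dist x t < d" using k by auto
      have "dist (v n t) (u t) \<le> dist (v n x) (v n t) + dist (v n x) (u x) + dist (u x) (u t)"
        using dist_triangle[of "v n t" "u t" "v n x"] dist_triangle[of "v n x" "u t" "u x"]
        by (simp add: dist_commute)
      also have "\<dots> < e"
        using close[OF x(2), of n] lim_close[OF x(2)] elim x(1) e by fastforce
      finally show "dist (v n t) (u t) < e" .
    qed
  qed
qed

lemma periodic_int_shift:
  fixes \<omega> :: real
  assumes per: "\<And>t. u (t + \<omega>) = u t"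
  shows "u (t + of_int n * \<omega>) = u t"
proof (induction n)
  case (nonneg n)
  show ?case
  proof (induction n)
    case (Suc n)
    then show ?case using per[of "t + real n * \<omega>"] by (simp add: algebra_simps)
  qed simp
next
  case (neg n)
  show ?case
  proof (induction n)
    case 0
    then show ?case using per[of "t - \<omega>"] by simp
  next
    case (Suc n)
    then show ?case using per[of "t - \<omega> - \<omega> - real n * \<omega>"] by (simp add: algebra_simps)
  qed
qed

lemma C_per_bounded:
  assumes u: "u \<in> C_per \<omega>" and \<omega>: "\<omega> > 0"
  obtains B where "B > 0" "\<And>t. norm (u t) \<le> B"
proof -
  have per: "\<And>t. u (t + \<omega>) = u t" using u by (auto simp: C_per_def)
  have "continuous_on {0..\<omega>} u" using u by (auto simp: C_per_def intro: continuous_on_subset)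
  then have "bounded (u ` {0..\<omega>})" by (intro compact_imp_bounded compact_continuous_image) auto
  then obtain B where B: "B > 0" "\<And>t. t \<in> {0..\<omega>} \<Longrightarrow> norm (u t) \<le> B"
    unfolding bounded_pos by auto
  have "norm (u t) \<le> B" for t
  proof -
    define n where "n = \<lfloor>t / \<omega>\<rfloor>"
    have "of_int n \<le> t / \<omega>" "t / \<omega> < of_int n + 1" by (auto simp: n_def)
    then have "t + of_int (- n) * \<omega> \<in> {0..\<omega>}" using \<omega> by (auto simp: field_simps)
    then show ?thesis using B(2) periodic_int_shift[of u \<omega>, OF per, of t "- n"] by metis
  qed
  with B(1) that show ?thesis by blast
qed

lemma C_per_norm_tendsto_zero:
  assumes lim: "uniform_limit {0..\<omega>} v u sequentially" and \<omega>: "\<omega> > 0"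
  shows "(\<lambda>i. C_per_norm \<omega> (\<lambda>t. v i t - u t)) \<longlonglongrightarrow> 0"
proof (rule tendstoI)
  fix e :: real assume e: "0 < e"
  have "\<forall>\<^sub>F i in sequentially. \<forall>t\<in>{0..\<omega>}. dist (v i t) (u t) < e / 2"
    using lim e by (intro uniform_limitD) auto
  then show "\<forall>\<^sub>F i in sequentially. dist (C_per_norm \<omega> (\<lambda>t. v i t - u t)) 0 < e"
  proof eventually_elim
    case (elim i)
    have le: "norm (v i t - u t) \<le> e / 2" if "t \<in> {0..\<omega>}" for t
      using elim that by (auto simp: dist_norm intro: less_imp_le)
    have "C_per_norm \<omega> (\<lambda>t. v i t - u t) \<le> e / 2"
      unfolding C_per_norm_def using le \<omega> by (intro cSUP_least) auto
    moreover have "norm (v i 0 - u 0) \<le> C_per_norm \<omega> (\<lambda>t. v i t - u t)"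
      unfolding C_per_norm_def using le \<omega> by (intro cSUP_upper bdd_aboveI2[where M="e / 2"]) auto
    then have "0 \<le> C_per_norm \<omega> (\<lambda>t. v i t - u t)"
      by (rule order_trans[OF norm_ge_zero])
    ultimately show ?case using e by simp
  qed
qed

section \<open>Compactness estimates for the linear periodic solution operator\<close>

context stable_semigroup
begin

text \<open>Cutting the integral off at distance \<open>\<epsilon>\<close> from \<open>t\<close> leaves a term in the image of a fixed ball
  under \<open>S \<epsilon>\<close> and an error of order \<open>\<epsilon>\<close>, uniformly in \<open>f\<close> and \<open>t\<close>.\<close>

lemma periodic_solution_compact_range:
  assumes cpt: "compact_semigroup S" and G: "G \<ge> 0"
  obtains K where "compact K"
    "\<And>f t. continuous_on UNIV f \<Longrightarrow> (\<And>r. norm (f r) \<le> G) \<Longrightarrow> periodic_solution f t \<in> K"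
proof -
  define X where
    "X = {periodic_solution f t | f t. continuous_on UNIV f \<and> (\<forall>r. norm (f r) \<le> G)}"
  have "compact (closure X)"
    unfolding compact_eq_totally_bounded
  proof (intro conjI allI impI)
    show "complete (closure X)" by (simp add: complete_eq_closed)
    fix e :: real assume e: "e > 0"
    \<comment> \<open>The first bound keeps the cut inside the period; the second brings the
      discarded piece, of size at most \<open>norm R * (M * G * \<epsilon>)\<close>, below
      \<open>e / 3\<close>. The added 1 excludes a zero denominator and gives strictness. The other
      two thirds of \<open>e\<close> pay for the closure and for the finite net.\<close>
    define \<epsilon> where "\<epsilon> = min \<omega> (e / (3 * (norm R * M * G + 1)))"
    have pos: "norm R * M * G + 1 > 0" using M G by (intro add_nonneg_pos) auto
    have \<epsilon>: "0 < \<epsilon>" "\<epsilon> \<le> \<omega>" using e \<omega> pos by (auto simp: \<epsilon>_def)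
    have "\<epsilon> \<le> e / (3 * (norm R * M * G + 1))" by (simp add: \<epsilon>_def)
    then have "(norm R * M * G + 1) * \<epsilon> \<le> e / 3" using pos by (simp add: field_simps)
    then have small: "norm R * (M * G * \<epsilon>) < e / 3" using \<epsilon> by (simp add: algebra_simps)
    define K where "K = R ` closure (S \<epsilon> ` cball 0 (M * G * \<omega>))"
    have "compact K"
      unfolding K_def using cpt \<epsilon>
      by (intro compact_continuous_image continuous_intros)
        (auto simp: compact_semigroup_def compact_operator_def)
    then obtain k where k: "finite k" "K \<subseteq> (\<Union>x\<in>k. ball x (e / 3))"
      unfolding compact_eq_totally_bounded using divide_pos_pos[OF e zero_less_numeral] by blast
    have "closure X \<subseteq> (\<Union>x\<in>k. ball x e)"
    proof
      fix p assume "p \<in> closure X"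
      then obtain y where "y \<in> X" and yp: "dist y p < e / 3"
        unfolding closure_approachable using divide_pos_pos[OF e zero_less_numeral] by blast
      then obtain f t where y: "y = periodic_solution f t" and f: "continuous_on UNIV f"
        and bd: "\<And>r. norm (f r) \<le> G" by (auto simp: X_def)
      define z where "z = R (S \<epsilon> (duhamel S f (t - \<omega>) (t - \<epsilon>) (t - \<epsilon>)))"
      have "norm (duhamel S f (t - \<omega>) (t - \<epsilon>) (t - \<epsilon>)) \<le> M * G * (t - \<epsilon> - (t - \<omega>))"
        using \<epsilon> by (intro norm_duhamel_le C0 f norm_le_M bd) auto
      also have "\<dots> \<le> M * G * \<omega>" using \<epsilon> M G by (intro mult_left_mono) auto
      finally have "duhamel S f (t - \<omega>) (t - \<epsilon>) (t - \<epsilon>) \<in> cball 0 (M * G * \<omega>)" by simp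
      then have "z \<in> K"
        unfolding z_def K_def by (intro imageI subsetD[OF closure_subset])
      then obtain x where x: "x \<in> k" "dist x z < e / 3" using k by auto
      have "duhamel S f (t - \<omega>) t t - S \<epsilon> (duhamel S f (t - \<omega>) (t - \<epsilon>) (t - \<epsilon>)) =
          duhamel S f (t - \<epsilon>) t t"
        using duhamel_combine[OF C0 f, of "t - \<omega>" "t - \<epsilon>" t t] \<epsilon>
          semigroup_duhamel[OF C0 f, of "t - \<epsilon>" "t - \<epsilon>" \<epsilon> "t - \<omega>"]
        by (simp add: algebra_simps)
      then have "y - z = R (duhamel S f (t - \<epsilon>) t t)"
        by (simp add: y z_def periodic_solution_def flip: blinfun.diff_right)
      then have "norm (y - z) \<le> norm R * norm (duhamel S f (t - \<epsilon>) t t)"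
        by (simp add: norm_blinfun)
      also have "\<dots> \<le> norm R * (M * G * (t - (t - \<epsilon>)))"
        using \<epsilon> by (intro mult_left_mono norm_duhamel_le C0 f norm_le_M bd) auto
      finally have "dist y z < e / 3" using small by (simp add: dist_norm)
      then have "dist x p < e"
        using x yp dist_triangle[of x p y] dist_triangle[of x y z]
        by (simp add: dist_commute)
      with x show "p \<in> (\<Union>x\<in>k. ball x e)" by auto
    qed
    with k show "\<exists>k. finite k \<and> closure X \<subseteq> (\<Union>x\<in>k. ball x e)" by blast
  qed
  moreover have "periodic_solution f t \<in> closure X"
    if "continuous_on UNIV f" "\<And>r. norm (f r) \<le> G" for f t
    using that closure_subset[of X] by (auto simp: X_def)
  ultimately show ?thesis using that by blast
qed

lemma periodic_solution_equicontinuous: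
  assumes cpt: "compact_semigroup S" and G: "G \<ge> 0" and e: "e > 0"
  obtains d where "d > 0"
    "\<And>f s t. \<lbrakk>continuous_on UNIV f; \<And>r. norm (f r) \<le> G; \<And>r. f (r + \<omega>) = f r; dist s t < d\<rbrakk>
      \<Longrightarrow> dist (periodic_solution f s) (periodic_solution f t) < e"
proof -
  obtain K where K: "compact K"
    and inK: "\<And>f t. continuous_on UNIV f \<Longrightarrow> (\<And>r. norm (f r) \<le> G) \<Longrightarrow> periodic_solution f t \<in> K"
    using periodic_solution_compact_range[OF cpt G] by metis
  \<comment> \<open>Heine-Cantor on a compact product, used at pairs \<open>(0, x)\<close> and
    \<open>(h, x)\<close>, makes \<open>S h x - x\<close> small uniformly in
    \<open>x \<in> K\<close> although only strong continuity is assumed.\<close>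
  have "uniformly_continuous_on ({0..1} \<times> K) (\<lambda>(t, x). S t x)"
    by (intro compact_uniformly_continuous compact_Times K compact_Icc
        continuous_on_subset[OF C0_semigroup_continuous_on[OF C0]]) auto
  then obtain d where d: "d > 0" and uc: "\<And>p q. \<lbrakk>p \<in> {0..1} \<times> K; q \<in> {0..1} \<times> K; dist q p < d\<rbrakk>
      \<Longrightarrow> dist (case q of (t, x) \<Rightarrow> S t x) (case p of (t, x) \<Rightarrow> S t x) < e / 2"
    unfolding uniformly_continuous_on_def using e by (metis half_gt_zero)
  \<comment> \<open>The three bounds keep the time step in \<open>{0..1}\<close>, make the semigroup
    term smaller than \<open>e / 2\<close>, and bound the integral over the step by
    \<open>e / 2\<close>.\<close>
  define d' where "d' = min (min 1 d) (e / (2 * (M * G + 1)))"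
  have pos: "M * G + 1 > 0" using M G by (intro add_nonneg_pos) auto
  have d': "d' > 0" using d e pos by (simp add: d'_def)
  have *: "dist (periodic_solution f s) (periodic_solution f t) < e"
    if f: "continuous_on UNIV f" and bd: "\<And>r. norm (f r) \<le> G" and per: "\<And>r. f (r + \<omega>) = f r"
      and st: "s \<le> t" "t - s < d'" for f s t
  proof -
    have "dist (t - s, periodic_solution f s) (0, periodic_solution f s) < d"
      using st by (simp add: dist_Pair_Pair d'_def)
    then have "dist (S (t - s) (periodic_solution f s)) (S 0 (periodic_solution f s)) < e / 2"
      using uc[of "(0, periodic_solution f s)" "(t - s, periodic_solution f s)"] inK[OF f bd] st
      by (simp add: d'_def)
    then have 1: "norm (S (t - s) (periodic_solution f s) - periodic_solution f s) < e / 2"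
      using C0_semigroup_zero[OF C0] by (simp add: dist_norm)
    have "norm (duhamel S f s t t) \<le> M * G * (t - s)"
      using st by (intro norm_duhamel_le C0 f norm_le_M bd) auto
    also have "\<dots> \<le> (M * G + 1) * (t - s)" using st by (intro mult_right_mono) auto
    also have "\<dots> \<le> (M * G + 1) * (e / (2 * (M * G + 1)))"
      using st pos by (intro mult_left_mono) (auto simp: d'_def)
    also have "\<dots> = e / 2" using pos by (simp add: divide_simps)
    finally have 2: "norm (duhamel S f s t t) \<le> e / 2" .
    have "periodic_solution f t - periodic_solution f s =
        (S (t - s) (periodic_solution f s) - periodic_solution f s) + duhamel S f s t t"
      using periodic_solution_mild[OF f per] st unfolding linear_mild_solution_def by auto
    then have "norm (periodic_solution f t - periodic_solution f s) < e"
      using 1 2 norm_triangle_ineq by (smt (verit) field_sum_of_halves)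
    then show ?thesis by (simp add: dist_norm norm_minus_commute)
  qed
  have "dist (periodic_solution f s) (periodic_solution f t) < e"
    if "continuous_on UNIV f" "\<And>r. norm (f r) \<le> G" "\<And>r. f (r + \<omega>) = f r" "dist s t < d'" for f s t
  proof (cases "s \<le> t")
    case True
    then show ?thesis using *[of f s t] that by (simp add: dist_real_def)
  next
    case False
    then show ?thesis using *[of f t s] that by (simp add: dist_real_def dist_commute)
  qed
  with d' that show ?thesis by blast
qed

text \<open>A periodic continuous source is bounded, so continuity is the equicontinuity estimate
  for a single function.\<close>

lemma periodic_solution_C_per:
  assumes cpt: "compact_semigroup S" and f: "f \<in> C_per \<omega>"
  shows "periodic_solution f \<in> C_per \<omega>"
proof -
  have f': "continuous_on UNIV f" "\<And>r. f (r + \<omega>) = f r" using f by (auto simp: C_per_def)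
  obtain G where G: "G > 0" "\<And>t. norm (f t) \<le> G" using C_per_bounded[OF f \<omega>] by metis
  have "continuous_on UNIV (periodic_solution f)"
    unfolding continuous_on_iff
  proof (intro ballI allI impI)
    fix t e :: real assume "e > 0"
    then obtain d where "d > 0" "\<And>s. dist s t < d \<Longrightarrow> dist (periodic_solution f s) (periodic_solution f t) < e"
      using periodic_solution_equicontinuous[OF cpt less_imp_le[OF G(1)]] f' G(2) by metis
    then show "\<exists>d>0. \<forall>s\<in>UNIV. dist s t < d \<longrightarrow> dist (periodic_solution f s) (periodic_solution f t) < e"
      by blast
  qed
  with periodic_solution_periodic[of f, OF f'(2)] show ?thesis by (simp add: C_per_def)
qed

lemma periodic_solution_tendsto:
  assumes f: "\<And>n. continuous_on UNIV (f n)" and g: "continuous_on UNIV g"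
    and lim: "uniform_limit {t - \<omega>..t} f g sequentially"
  shows "(\<lambda>n. periodic_solution (f n) t) \<longlonglongrightarrow> periodic_solution g t"
proof -
  have "uniform_limit {t - \<omega>..t} (\<lambda>n r. S (t - r) (f n r)) (\<lambda>r. S (t - r) (g r)) sequentially"
  proof (rule uniform_limitI)
    fix e :: real assume e: "0 < e"
    have "\<forall>\<^sub>F n in sequentially. \<forall>r\<in>{t - \<omega>..t}. dist (f n r) (g r) < e / M"
      using lim e M by (intro uniform_limitD) auto
    then show "\<forall>\<^sub>F n in sequentially. \<forall>r\<in>{t - \<omega>..t}. dist (S (t - r) (f n r)) (S (t - r) (g r)) < e"
    proof eventually_elim
      case (elim n)
      show ?case
      proof
        fix r assume r: "r \<in> {t - \<omega>..t}"
        have "dist (S (t - r) (f n r)) (S (t - r) (g r)) = norm (S (t - r) (f n r - g r))"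
          by (simp add: dist_norm blinfun.diff_right)
        also have "\<dots> \<le> norm (S (t - r)) * norm (f n r - g r)" by (rule norm_blinfun)
        also have "\<dots> \<le> M * norm (f n r - g r)"
          using r by (intro mult_right_mono norm_le_M) auto
        also have "\<dots> < M * (e / M)"
          using elim r M by (intro mult_strict_left_mono) (auto simp: dist_norm)
        finally show "dist (S (t - r) (f n r)) (S (t - r) (g r)) < e" using M by simp
      qed
    qed
  qed
  then obtain I J where I: "\<And>n. ((\<lambda>r. S (t - r) (f n r)) has_integral I n) {t - \<omega>..t}"
    and J: "((\<lambda>r. S (t - r) (g r)) has_integral J) {t - \<omega>..t}" and "I \<longlonglongrightarrow> J"
    using uniform_limit_integral continuous_on_convolution[OF C0 f order_refl]
      trivial_limit_sequentially by blast
  then have "(\<lambda>n. duhamel S (f n) (t - \<omega>) t t) \<longlonglongrightarrow> duhamel S g (t - \<omega>) t t"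
    by (simp add: duhamel_def integral_unique[OF I] integral_unique[OF J])
  then show ?thesis
    unfolding periodic_solution_def by (intro blinfun.tendsto tendsto_const)
qed

end

section \<open>Monotone iteration\<close>

locale positive_stable_semigroup = stable_semigroup S M \<delta> \<omega>
  for S :: "real \<Rightarrow> 'a::{banach, ordered_real_vector} \<Rightarrow>\<^sub>L 'a" and M \<delta> \<omega> +
  assumes cone_closed: "closed (positive_cone :: 'a set)"
    and positive: "positive_semigroup S"
begin

lemma R_nonneg: "0 \<le> x \<Longrightarrow> 0 \<le> R x"
proof -
  assume x: "0 \<le> x"
  have "(\<lambda>n. S (real n * \<omega>) x) sums R x"
    by (rule bounded_linear.sums[OF blinfun.bounded_linear_left R_sums])
  then have "(\<lambda>n. \<Sum>i<n. S (real i * \<omega>) x) \<longlonglongrightarrow> R x" by (simp add: sums_def)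
  moreover have "0 \<le> (\<Sum>i<n. S (real i * \<omega>) x)" for n
    using positive x \<omega> by (intro sum_nonneg) (simp add: positive_semigroup_def)
  ultimately show ?thesis
    by (intro tendsto_le_closed_cone[OF cone_closed tendsto_const]) auto
qed

lemma periodic_solution_mono:
  assumes f: "continuous_on UNIV f" and h: "continuous_on UNIV h" and le: "f \<le> h"
  shows "periodic_solution f \<le> periodic_solution h"
proof (rule le_funI)
  fix t
  have "0 \<le> integral {t - \<omega>..t} (\<lambda>r. S (t - r) (h r) - S (t - r) (f r))"
  proof (rule integral_nonneg_closed_cone[OF cone_closed])
    show "(\<lambda>r. S (t - r) (h r) - S (t - r) (f r)) integrable_on {t - \<omega>..t}"
      by (intro integrable_diff integrable_convolution C0 f h order_refl)
    fix r assume "r \<in> {t - \<omega>..t}"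
    then have "0 \<le> S (t - r) (h r - f r)"
      using positive le by (simp add: positive_semigroup_def le_fun_def)
    then show "0 \<le> S (t - r) (h r) - S (t - r) (f r)" by (simp add: blinfun.diff_right)
  qed
  also have "\<dots> = duhamel S h (t - \<omega>) t t - duhamel S f (t - \<omega>) t t"
    unfolding duhamel_def
    by (intro Henstock_Kurzweil_Integration.integral_diff integrable_convolution C0 f h order_refl)
  finally have "0 \<le> R (duhamel S h (t - \<omega>) t t - duhamel S f (t - \<omega>) t t)" by (rule R_nonneg)
  then show "periodic_solution f t \<le> periodic_solution h t"
    by (simp add: periodic_solution_def blinfun.diff_right)
qed

end

text \<open>The lower and upper solutions enter only as ordered periodic functions with
  \<open>v0 \<le> Q v0\<close> and \<open>Q w0 \<le> w0\<close>; generator, domain and derivatives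
  stay outside the iteration.\<close>

locale monotone_iteration = positive_stable_semigroup S M \<delta> \<omega>
  for S :: "real \<Rightarrow> 'a::{banach, ordered_real_vector} \<Rightarrow>\<^sub>L 'a" and M \<delta> \<omega> +
  fixes g :: "real \<Rightarrow> 'a \<Rightarrow> 'a \<Rightarrow> 'a" and \<tau> :: real and v0 w0 :: "real \<Rightarrow> 'a"
  assumes cone_normal: "normal_cone (positive_cone :: 'a set)"
    and compact: "compact_semigroup S"
    and g_continuous: "continuous_on UNIV (\<lambda>(t, x, y). g t x y)"
    and g_periodic: "g (t + \<omega>) x y = g t x y"
    and g_mono: "\<lbrakk>v0 t \<le> x1; x1 \<le> x2; x2 \<le> w0 t; v0 (t - \<tau>) \<le> y1; y1 \<le> y2; y2 \<le> w0 (t - \<tau>)\<rbrakk>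
      \<Longrightarrow> g t x1 y1 \<le> g t x2 y2"
    and v0: "v0 \<in> C_per \<omega>" and w0: "w0 \<in> C_per \<omega>" and v0_le_w0: "v0 \<le> w0"
    and v0_le: "v0 \<le> periodic_solution (\<lambda>t. g t (v0 t) (v0 (t - \<tau>)))"
    and le_w0: "periodic_solution (\<lambda>t. g t (w0 t) (w0 (t - \<tau>))) \<le> w0"
begin

definition N :: "(real \<Rightarrow> 'a) \<Rightarrow> real \<Rightarrow> 'a" where
  "N u t = g t (u t) (u (t - \<tau>))"

definition Q :: "(real \<Rightarrow> 'a) \<Rightarrow> real \<Rightarrow> 'a" where
  "Q u = periodic_solution (N u)"

definition I :: "(real \<Rightarrow> 'a) set" where
  "I = {u \<in> C_per \<omega>. v0 \<le> u \<and> u \<le> w0}"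

lemma N_continuous:
  assumes "continuous_on UNIV u"
  shows "continuous_on UNIV (N u)"
proof -
  have "continuous_on UNIV (\<lambda>t. (\<lambda>(t, x, y). g t x y) (t, u t, u (t - \<tau>)))"
    by (intro continuous_on_compose2[OF g_continuous] continuous_intros assms
        continuous_on_compose2[OF assms]) auto
  then show ?thesis by (simp add: N_def[abs_def])
qed

lemma N_C_per:
  assumes u: "u \<in> C_per \<omega>"
  shows "N u \<in> C_per \<omega>"
proof -
  have per: "u (t + \<omega>) = u t" for t using u by (simp add: C_per_def)
  have "N u (t + \<omega>) = N u t" for t
    using per[of "t - \<tau>"] by (simp add: N_def g_periodic per diff_add_eq)
  with u show ?thesis by (simp add: C_per_def N_continuous)
qed

lemma I_C_per: "u \<in> I \<Longrightarrow> u \<in> C_per \<omega>"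
  by (simp add: I_def)

lemma v0_I: "v0 \<in> I" and w0_I: "w0 \<in> I"
  using v0 w0 v0_le_w0 by (auto simp: I_def)

lemma N_mono: "v0 \<le> u \<Longrightarrow> u \<le> v \<Longrightarrow> v \<le> w0 \<Longrightarrow> N u \<le> N v"
  unfolding N_def le_fun_def by (intro allI g_mono) auto

lemma Q_mono: "u \<in> I \<Longrightarrow> v \<in> I \<Longrightarrow> u \<le> v \<Longrightarrow> Q u \<le> Q v"
  unfolding Q_def
  by (intro periodic_solution_mono N_continuous N_mono) (auto simp: I_def C_per_def)

lemma v0_le_Q: "v0 \<le> Q v0" and Q_le_w0: "Q w0 \<le> w0"
  using v0_le le_w0 by (simp_all add: Q_def N_def[abs_def])

lemma Q_I: "u \<in> I \<Longrightarrow> Q u \<in> I"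
proof -
  assume u: "u \<in> I"
  then have "v0 \<le> u" "u \<le> w0" by (auto simp: I_def)
  then have "v0 \<le> Q u" "Q u \<le> w0"
    using Q_mono[OF v0_I u] Q_mono[OF u w0_I] v0_le_Q Q_le_w0 by auto
  moreover have "Q u \<in> C_per \<omega>"
    unfolding Q_def by (intro periodic_solution_C_per compact N_C_per I_C_per u)
  ultimately show ?thesis by (simp add: I_def)
qed

text \<open>\<open>N u\<close> lies between \<open>N v0\<close> and \<open>N w0\<close>, so normality of the cone bounds it.\<close>

lemma N_bounded:
  obtains G where "G \<ge> 0" "\<And>u t. u \<in> I \<Longrightarrow> norm (N u t) \<le> G"
proof -
  obtain a where a: "a > 0" "\<And>t. norm (N v0 t) \<le> a"
    using C_per_bounded[OF N_C_per[OF v0] \<omega>] by metis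
  obtain b where b: "b > 0" "\<And>t. norm (N w0 t) \<le> b"
    using C_per_bounded[OF N_C_per[OF w0] \<omega>] by metis
  obtain c where c: "c > 0" "\<And>x y :: 'a. 0 \<le> x \<Longrightarrow> x \<le> y \<Longrightarrow> norm x \<le> c * norm y"
    using normal_cone_bound[OF cone_normal] by metis
  have "norm (N u t) \<le> a + c * (a + b)" if u: "u \<in> I" for u t
  proof -
    have "N v0 t \<le> N u t" "N u t \<le> N w0 t"
      using N_mono[of v0 u] N_mono[of u w0] u by (auto simp: I_def le_fun_def)
    then have "norm (N u t - N v0 t) \<le> c * norm (N w0 t - N v0 t)"
      by (intro c(2)) (auto intro: diff_right_mono)
    also have "\<dots> \<le> c * (a + b)"
      using norm_triangle_ineq4[of "N w0 t" "N v0 t"] a(2)[of t] b(2)[of t] c(1)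
      by (intro mult_left_mono) auto
    finally show ?thesis
      using norm_triangle_sub[of "N u t" "N v0 t"] a(2)[of t] by linarith
  qed
  moreover have "a + c * (a + b) \<ge> 0" using a(1) b(1) c(1) by simp
  ultimately show ?thesis using that by blast
qed

text \<open>Confining all values to the compact set \<open>K\<close> makes \<open>g\<close>
  uniformly continuous on the relevant product, which boundedness alone would not give in infinite
  dimension.\<close>

lemma N_uniform_limit:
  assumes K: "compact K" "\<And>n t. v n t \<in> K" "\<And>t. u t \<in> K"
    and lim: "\<And>X. compact X \<Longrightarrow> uniform_limit X v u sequentially"
  shows "uniform_limit {a..b} (\<lambda>n. N (v n)) (N u) sequentially"
proof (rule uniform_limitI)
  fix e :: real assume e: "0 < e"
  have "uniformly_continuous_on ({a..b} \<times> K \<times> K) (\<lambda>(t, x, y). g t x y)"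
    by (intro compact_uniformly_continuous compact_Times K compact_Icc
        continuous_on_subset[OF g_continuous]) auto
  then obtain d where d: "d > 0" and uc: "\<And>p q. \<lbrakk>p \<in> {a..b} \<times> K \<times> K; q \<in> {a..b} \<times> K \<times> K; dist q p < d\<rbrakk>
      \<Longrightarrow> dist (case q of (t, x, y) \<Rightarrow> g t x y) (case p of (t, x, y) \<Rightarrow> g t x y) < e"
    unfolding uniformly_continuous_on_def using e by meson
  \<comment> \<open>The interval is widened to contain both \<open>s\<close> and the delayed time
    \<open>s - \<tau>\<close>; each contributes half of \<open>d\<close>.\<close>
  have "\<forall>\<^sub>F n in sequentially. \<forall>s\<in>{a - \<bar>\<tau>\<bar>..b + \<bar>\<tau>\<bar>}. dist (v n s) (u s) < d / 2"
    using lim[OF compact_Icc] d by (intro uniform_limitD) auto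
  then show "\<forall>\<^sub>F n in sequentially. \<forall>s\<in>{a..b}. dist (N (v n) s) (N u s) < e"
  proof eventually_elim
    case (elim n)
    show ?case
    proof
      fix s assume s: "s \<in> {a..b}"
      have "dist (s, v n s, v n (s - \<tau>)) (s, u s, u (s - \<tau>)) \<le>
          dist (v n s) (u s) + dist (v n (s - \<tau>)) (u (s - \<tau>))"
        by (simp add: dist_Pair_Pair sqrt_sum_squares_le_sum)
      also have "\<dots> < d"
      proof -
        have "s \<in> {a - \<bar>\<tau>\<bar>..b + \<bar>\<tau>\<bar>}" "s - \<tau> \<in> {a - \<bar>\<tau>\<bar>..b + \<bar>\<tau>\<bar>}"
          using s abs_ge_self[of \<tau>] abs_ge_minus_self[of \<tau>] by auto
        from this[THEN bspec[OF elim]] show ?thesis by simp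
      qed
      finally show "dist (N (v n) s) (N u s) < e"
        using uc[of "(s, u s, u (s - \<tau>))" "(s, v n s, v n (s - \<tau>))"] s K by (simp add: N_def)
    qed
  qed
qed

text \<open>Increasing and decreasing sequences are treated together, since both starting functions
  are needed.\<close>

lemma iteration_limit:
  assumes v: "\<And>n. v n \<in> I" and step: "\<And>n. v (Suc n) = Q (v n)"
    and mono: "(\<forall>n. v n \<le> v (Suc n)) \<or> (\<forall>n. v (Suc n) \<le> v n)"
  obtains u where "u \<in> I" "Q u = u" "tendsto_C_per \<omega> v u" "\<And>t. (\<lambda>n. v n t) \<longlonglongrightarrow> u t"
proof -
  \<comment> \<open>The starting function is not known to be a value of \<open>Q\<close>, so the
    compact set and the common modulus of continuity are available only from index 1 on.\<close>
  define x where "x n = v (Suc n)" for n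
  have Nv: "continuous_on UNIV (N (v n))" "N (v n) (r + \<omega>) = N (v n) r" for n r
    using N_C_per[OF I_C_per[OF v]] by (auto simp: C_per_def)
  have x_eq: "x n = periodic_solution (N (v n))" for n by (simp add: x_def step Q_def)
  obtain G where G: "G \<ge> 0" "\<And>u t. u \<in> I \<Longrightarrow> norm (N u t) \<le> G" using N_bounded by metis
  obtain K where K: "compact K"
    and range_K: "\<And>f t. continuous_on UNIV f \<Longrightarrow> (\<And>r. norm (f r) \<le> G) \<Longrightarrow> periodic_solution f t \<in> K"
    using periodic_solution_compact_range[OF compact G(1)] by metis
  have inK: "x n t \<in> K" for n t
    unfolding x_eq by (intro range_K Nv G(2) v)
  have "\<exists>l. (\<lambda>n. x n t) \<longlonglongrightarrow> l" for t
    using mono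
    by (intro monotone_in_compact_converges[OF cone_closed cone_normal K inK])
      (auto simp: x_def le_fun_def)
  then obtain u where u: "\<And>t. (\<lambda>n. x n t) \<longlonglongrightarrow> u t" by metis
  have uK: "u t \<in> K" for t
    by (rule closed_sequentially[OF compact_imp_closed[OF K] inK u])
  have equi: "\<exists>d>0. \<forall>n s t. dist s t < d \<longrightarrow> dist (x n s) (x n t) < e" if "e > 0" for e
    using periodic_solution_equicontinuous[OF compact G(1) that] Nv G(2)[OF v]
    unfolding x_eq by metis
  have unif: "uniform_limit X x u sequentially" if "compact X" for X
    by (rule equicontinuous_pointwise_imp_uniform_limit[OF that equi u])
  have "continuous_on UNIV u"
    unfolding continuous_on_iff
  proof (intro ballI allI impI)
    fix t e :: real assume "e > 0"
    then obtain d where d: "d > 0" "\<And>n s t. dist s t < d \<Longrightarrow> dist (x n s) (x n t) < e / 2"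
      using equi[of "e / 2"] by auto
    have "dist (u s) (u t) < e" if "dist s t < d" for s
    proof -
      have "dist (u s) (u t) \<le> e / 2"
        by (rule tendsto_upperbound[OF tendsto_dist[OF u u]])
          (use d(2)[OF that] in \<open>auto intro!: always_eventually less_imp_le\<close>)
      with \<open>e > 0\<close> show ?thesis by simp
    qed
    with d show "\<exists>d>0. \<forall>s\<in>UNIV. dist s t < d \<longrightarrow> dist (u s) (u t) < e" by blast
  qed
  moreover have "u (t + \<omega>) = u t" for t
  proof -
    have "x n (t + \<omega>) = x n t" for n using I_C_per[OF v] by (auto simp: x_def C_per_def)
    then show ?thesis using LIMSEQ_unique[OF u[of "t + \<omega>"]] u[of t] by simp
  qed
  ultimately have u_per: "u \<in> C_per \<omega>" by (simp add: C_per_def)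
  have "v0 t \<le> u t" "u t \<le> w0 t" for t
    using v by (auto intro!: tendsto_le_closed_cone[OF cone_closed tendsto_const u]
        tendsto_le_closed_cone[OF cone_closed u tendsto_const] always_eventually
        simp: x_def I_def le_fun_def)
  with u_per have uI: "u \<in> I" by (simp add: I_def le_fun_def)
  \<comment> \<open>\<open>Q\<close> is continuous along this uniformly convergent sequence, and
    \<open>Q (x n)\<close> is the next member, so both sides are limits of the same
    sequence.\<close>
  have "Q u = u"
  proof
    fix t
    have "(\<lambda>n. periodic_solution (N (x n)) t) \<longlonglongrightarrow> Q u t"
      unfolding Q_def x_def using u_per
      by (intro periodic_solution_tendsto Nv N_continuous)
        (auto simp: C_per_def x_def[symmetric] intro!: N_uniform_limit[OF K inK uK unif])
    moreover have "periodic_solution (N (x n)) = x (Suc n)" for n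
      by (simp add: x_def step Q_def)
    ultimately show "Q u t = u t"
      using LIMSEQ_unique[OF _ LIMSEQ_Suc[OF u[of t]]] by simp
  qed
  moreover have "(\<lambda>i. C_per_norm \<omega> (\<lambda>t. v i t - u t)) \<longlonglongrightarrow> 0"
    by (rule LIMSEQ_imp_Suc)
      (use C_per_norm_tendsto_zero[OF unif[OF compact_Icc] \<omega>] in \<open>simp add: x_def\<close>)
  then have "tendsto_C_per \<omega> v u"
    using u_per I_C_per[OF v] by (simp add: tendsto_C_per_def)
  moreover have "(\<lambda>n. v n t) \<longlonglongrightarrow> u t" for t
    by (rule LIMSEQ_imp_Suc) (use u[of t] in \<open>simp add: x_def\<close>)
  ultimately show ?thesis using that uI by blast
qed

lemma funpow_Q_I: "u \<in> I \<Longrightarrow> (Q ^^ n) u \<in> I"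
  by (induction n) (simp_all add: Q_I)

lemma funpow_Q_mono: "u \<in> I \<Longrightarrow> v \<in> I \<Longrightarrow> u \<le> v \<Longrightarrow> (Q ^^ n) u \<le> (Q ^^ n) v"
  by (induction n) (simp_all add: Q_mono funpow_Q_I)

lemma funpow_Q_increasing: "(Q ^^ n) v0 \<le> (Q ^^ Suc n) v0"
  using funpow_Q_mono[OF v0_I Q_I[OF v0_I] v0_le_Q] by (simp add: funpow_swap1)

lemma funpow_Q_decreasing: "(Q ^^ Suc n) w0 \<le> (Q ^^ n) w0"
  using funpow_Q_mono[OF Q_I[OF w0_I] w0_I Q_le_w0] by (simp add: funpow_swap1)

text \<open>A fixed point in \<open>I\<close> equals all its own iterates, so monotonicity of
  \<open>Q ^^ n\<close> traps it between the iterates of \<open>v0\<close> and of \<open>w0\<close>;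
  the closed cone preserves both inequalities in the limit.\<close>

theorem extremal_fixed_points:
  obtains umin umax where "umin \<in> I" "Q umin = umin" "umax \<in> I" "Q umax = umax"
    "tendsto_C_per \<omega> (\<lambda>n. (Q ^^ n) v0) umin" "tendsto_C_per \<omega> (\<lambda>n. (Q ^^ n) w0) umax"
    "\<And>u. u \<in> I \<Longrightarrow> Q u = u \<Longrightarrow> umin \<le> u \<and> u \<le> umax"
proof -
  obtain umin where umin: "umin \<in> I" "Q umin = umin" "tendsto_C_per \<omega> (\<lambda>n. (Q ^^ n) v0) umin"
    and lim_min: "\<And>t. (\<lambda>n. (Q ^^ n) v0 t) \<longlonglongrightarrow> umin t"
    using iteration_limit[of "\<lambda>n. (Q ^^ n) v0"] funpow_Q_I[OF v0_I] funpow_Q_increasing by auto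
  obtain umax where umax: "umax \<in> I" "Q umax = umax" "tendsto_C_per \<omega> (\<lambda>n. (Q ^^ n) w0) umax"
    and lim_max: "\<And>t. (\<lambda>n. (Q ^^ n) w0 t) \<longlonglongrightarrow> umax t"
    using iteration_limit[of "\<lambda>n. (Q ^^ n) w0"] funpow_Q_I[OF w0_I] funpow_Q_decreasing by auto
  have "umin \<le> u \<and> u \<le> umax" if u: "u \<in> I" "Q u = u" for u
  proof -
    have fixed: "(Q ^^ n) u = u" for n by (induction n) (simp_all add: u)
    have "v0 \<le> u" "u \<le> w0" using u by (auto simp: I_def)
    then have "(Q ^^ n) v0 \<le> u" "u \<le> (Q ^^ n) w0" for n
      using funpow_Q_mono[OF v0_I u(1), of n] funpow_Q_mono[OF u(1) w0_I, of n] by (simp_all add: fixed)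
    then show ?thesis
      by (auto simp: le_fun_def intro!: always_eventually
          tendsto_le_closed_cone[OF cone_closed lim_min tendsto_const]
          tendsto_le_closed_cone[OF cone_closed tendsto_const lim_max])
  qed
  with umin umax that show ?thesis by blast
qed

end

section \<open>Lower and upper solutions\<close>

text \<open>The infimum need not be attained; the strict inequality supplies an admissible exponent
  below \<open>c\<close>, and the gap becomes the decay rate of the damped semigroup.\<close>

lemma growth_exponent_less:
  assumes "growth_exponent T < ereal c"
  obtains \<nu> M where "\<nu> < c" "M \<ge> 1" "\<And>t. t \<ge> 0 \<Longrightarrow> norm (T t) \<le> M * exp (\<nu> * t)"
  using assms unfolding growth_exponent_def Inf_less_iff by auto

lemma growth_exponent_le:
  assumes "M \<ge> 1" "\<And>t. t \<ge> 0 \<Longrightarrow> norm (T t) \<le> M * exp (\<nu> * t)"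
  shows "growth_exponent T \<le> ereal \<nu>"
  unfolding growth_exponent_def using assms by (intro Inf_lower) auto

lemma positive_semigroup_damped:
  assumes "positive_semigroup T"
  shows "positive_semigroup (damped_semigroup c T)"
  using assms by (simp add: positive_semigroup_def damped_semigroup_apply scaleR_nonneg_nonneg)

lemma compact_semigroup_damped:
  assumes "compact_semigroup T"
  shows "compact_semigroup (damped_semigroup c T)"
  unfolding compact_semigroup_def compact_operator_def
proof (intro allI impI)
  fix t :: real and B :: "'a set"
  assume "t > 0" "bounded B"
  then have "compact ((\<lambda>x. exp (- c * t) *\<^sub>R x) ` closure (T t ` B))"
    using assms by (intro compact_scaling) (simp add: compact_semigroup_def compact_operator_def)
  moreover have "(\<lambda>x. exp (- c * t) *\<^sub>R x) ` closure (T t ` B) = closure (damped_semigroup c T t ` B)"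
    by (simp add: closure_scaleR image_image damped_semigroup_apply)
  ultimately show "compact (closure (damped_semigroup c T t ` B))" by simp
qed

lemma stable_semigroup_damped:
  assumes "C0_semigroup T" "\<nu> < c" "M \<ge> 1" "\<omega> > 0"
    and "\<And>t. t \<ge> 0 \<Longrightarrow> norm (T t) \<le> M * exp (\<nu> * t)"
  shows "stable_semigroup (damped_semigroup c T) M (c - \<nu>) \<omega>"
proof
  show "C0_semigroup (damped_semigroup c T)" by (rule C0_semigroup_damped[OF assms(1)])
  show "norm (damped_semigroup c T t) \<le> M * exp (- (c - \<nu>) * t)" if "0 \<le> t" for t
  proof -
    have "norm (damped_semigroup c T t) = exp (- c * t) * norm (T t)"
      by (simp add: damped_semigroup_def)
    also have "\<dots> \<le> exp (- c * t) * (M * exp (\<nu> * t))"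
      using assms(5)[OF that] by (intro mult_left_mono) auto
    also have "\<dots> = M * exp (- (c - \<nu>) * t)"
      by (simp add: algebra_simps flip: exp_add)
    finally show ?thesis .
  qed
qed (use assms in auto)

text \<open>By linearity on \<open>D\<close>, the graph norm of \<open>v s - v t\<close> dominates
  the norm of \<open>A (v s) - A (v t)\<close>.\<close>

lemma C_per_graph_continuous_operator:
  assumes A: "closed_linear_operator D A" and v: "v \<in> C_per_graph \<omega> D A"
  shows "continuous_on UNIV (\<lambda>t. A (v t))"
  unfolding continuous_on_def
proof (intro ballI)
  fix t
  have D: "v s \<in> D" for s using v by (simp add: C_per_graph_def)
  have diff: "A (x - y) = A x - A y" if "x \<in> D" "y \<in> D" for x y
  proof -
    have sub: "subspace D" and add: "\<And>x y. x \<in> D \<Longrightarrow> y \<in> D \<Longrightarrow> A (x + y) = A x + A y"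
      using A by (simp_all add: closed_linear_operator_def)
    show ?thesis using add[OF subspace_diff[OF sub that] that(2)] by (simp add: algebra_simps)
  qed
  have "((\<lambda>s. graph_norm A (v s - v t)) \<longlongrightarrow> 0) (at t)"
    using v by (simp add: C_per_graph_def)
  then have "((\<lambda>s. A (v s) - A (v t)) \<longlongrightarrow> 0) (at t)"
    by (rule Lim_null_comparison[rotated])
      (simp add: graph_norm_def diff[OF D D] always_eventually)
  then show "((\<lambda>s. A (v s)) \<longlongrightarrow> A (v t)) (at t)" by (simp add: LIM_zero_iff)
qed

text \<open>As the generator is \<open>- A\<close>, the residual is \<open>v' + A v\<close>. Its
  continuity makes it an admissible source for comparing linear periodic solutions.\<close>

lemma strict_solution_residual:
  fixes T :: "real \<Rightarrow> 'a::banach \<Rightarrow>\<^sub>L 'a"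
  assumes T: "C0_semigroup T" and A: "closed_linear_operator D A"
    and gen: "generates D (\<lambda>x. - A x) T" and v: "v \<in> C1_per \<omega> \<inter> C_per_graph \<omega> D A"
  shows "continuous_on UNIV (\<lambda>t. vector_derivative v (at t) + A (v t))"
    and "linear_mild_solution T (\<lambda>t. vector_derivative v (at t) + A (v t)) v"
proof -
  have C1: "\<And>t. v differentiable at t" "continuous_on UNIV (\<lambda>t. vector_derivative v (at t))"
    using v by (auto simp: C1_per_def C1_differentiable_on_eq)
  show "continuous_on UNIV (\<lambda>t. vector_derivative v (at t) + A (v t))"
    using v by (intro continuous_on_add C1 C_per_graph_continuous_operator[OF A]) auto
  have "linear_mild_solution T (\<lambda>t. vector_derivative v (at t) - - A (v t)) v"
    using v C1 by (intro strict_solution_imp_linear_mild_solution[OF T gen])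
      (auto simp: C_per_graph_def vector_derivative_works)
  then show "linear_mild_solution T (\<lambda>t. vector_derivative v (at t) + A (v t)) v" by simp
qed

context positive_stable_semigroup
begin

text \<open>By uniqueness \<open>v\<close> is itself \<open>periodic_solution h\<close>, so the
  claim is a comparison of sources.\<close>

lemma le_periodic_solution:
  assumes "linear_mild_solution S h v" "\<And>t. v (t + \<omega>) = v t"
    and "continuous_on UNIV h" "continuous_on UNIV f" "h \<le> f"
  shows "v \<le> periodic_solution f"
  using periodic_solution_unique[of h v, OF assms(1,2)] periodic_solution_mono[OF assms(3-5)] by simp

lemma periodic_solution_le:
  assumes "linear_mild_solution S h v" "\<And>t. v (t + \<omega>) = v t"
    and "continuous_on UNIV h" "continuous_on UNIV f" "f \<le> h"
  shows "periodic_solution f \<le> v"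
  using periodic_solution_unique[of h v, OF assms(1,2)] periodic_solution_mono[OF assms(4,3,5)] by simp

end

theorem theorem3p1:
  fixes D :: "'a::{banach, ordered_real_vector} set"
    and A :: "'a \<Rightarrow> 'a"
    and T :: "real \<Rightarrow> 'a \<Rightarrow>\<^sub>L 'a"
    and F :: "real \<Rightarrow> 'a \<Rightarrow> 'a \<Rightarrow> 'a"
    and \<omega> \<tau> C :: real
    and v0 w0 :: "real \<Rightarrow> 'a"
  assumes "closed (positive_cone :: 'a set)"
    and "normal_cone (positive_cone :: 'a set)"
    and "\<omega> > 0" and "\<tau> > 0"
    and "closed_linear_operator D A"
    and "C0_semigroup T"
    and "generates D (\<lambda>x. - A x) T"
    and "positive_semigroup T"
    and "compact_semigroup T"
    and "continuous_on UNIV (\<lambda>(t, x, y). F t x y)"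
    and "\<And>t x y. F (t + \<omega>) x y = F t x y"
    and "lower_solution D A F \<omega> \<tau> v0"
    and "upper_solution D A F \<omega> \<tau> w0"
    and "v0 \<le> w0"
    and "C \<ge> 0"
    and "\<And>t x1 x2 y1 y2.
           \<lbrakk>v0 t \<le> x1; x1 \<le> x2; x2 \<le> w0 t;
            v0 (t - \<tau>) \<le> y1; y1 \<le> y2; y2 \<le> w0 (t - \<tau>)\<rbrakk>
           \<Longrightarrow> F t x2 y2 - F t x1 y1 \<ge> - C *\<^sub>R (x2 - x1)"
  shows "\<exists>umin umax.
    minimal_maximal_mild_solutions T F \<omega> \<tau> v0 w0 umin umax \<and>
    (\<forall>C' \<ge> C. growth_exponent T < ereal C' \<longrightarrow>
       (let v = (\<lambda>i. (iteration_operator T F \<omega> \<tau> C' ^^ i) v0);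
            w = (\<lambda>i. (iteration_operator T F \<omega> \<tau> C' ^^ i) w0)
        in (\<forall>i. v i \<le> v (Suc i) \<and> v i \<le> w i \<and> w (Suc i) \<le> w i) \<and>
           tendsto_C_per \<omega> v umin \<and> tendsto_C_per \<omega> w umax))"
proof -
  note T = \<open>C0_semigroup T\<close>
  have v0: "v0 \<in> C1_per \<omega> \<inter> C_per_graph \<omega> D A"
    and lower: "\<And>t. vector_derivative v0 (at t) + A (v0 t) \<le> F t (v0 t) (v0 (t - \<tau>))"
    using \<open>lower_solution D A F \<omega> \<tau> v0\<close> by (simp_all add: lower_solution_def)
  have w0: "w0 \<in> C1_per \<omega> \<inter> C_per_graph \<omega> D A"
    and upper: "\<And>t. F t (w0 t) (w0 (t - \<tau>)) \<le> vector_derivative w0 (at t) + A (w0 t)"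
    using \<open>upper_solution D A F \<omega> \<tau> w0\<close> by (simp_all add: upper_solution_def)
  have C_per: "v0 \<in> C_per \<omega>" "w0 \<in> C_per \<omega>" using v0 w0 by (auto simp: C1_per_def)
  define f where "f u t = F t (u t) (u (t - \<tau>))" for u :: "real \<Rightarrow> 'a" and t
  have f_cont: "continuous_on UNIV (f u)" if "continuous_on UNIV u" for u
  proof -
    have "continuous_on UNIV (\<lambda>t. (\<lambda>(t, x, y). F t x y) (t, u t, u (t - \<tau>)))"
      by (intro continuous_on_compose2[OF assms(10)] continuous_intros that
          continuous_on_compose2[OF that]) auto
    then show ?thesis by (simp add: f_def[abs_def])
  qed
  define conv where "conv C' umin umax \<longleftrightarrow>
       (let v = (\<lambda>i. (iteration_operator T F \<omega> \<tau> C' ^^ i) v0);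
            w = (\<lambda>i. (iteration_operator T F \<omega> \<tau> C' ^^ i) w0)
        in (\<forall>i. v i \<le> v (Suc i) \<and> v i \<le> w i \<and> w (Suc i) \<le> w i) \<and>
           tendsto_C_per \<omega> v umin \<and> tendsto_C_per \<omega> w umax)" for C' umin umax
  \<comment> \<open>The pair may still depend on \<open>C'\<close> here, whereas the goal asks for
    one pair serving every admissible \<open>C'\<close>.\<close>
  have main: "\<exists>umin umax. minimal_maximal_mild_solutions T F \<omega> \<tau> v0 w0 umin umax \<and> conv C' umin umax"
    if C': "C' \<ge> C" "growth_exponent T < ereal C'" for C'
  proof -
    obtain \<nu> M where \<nu>: "\<nu> < C'" "M \<ge> 1" "\<And>t. t \<ge> 0 \<Longrightarrow> norm (T t) \<le> M * exp (\<nu> * t)"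
      using growth_exponent_less[OF C'(2)] by metis
    define S where "S = damped_semigroup C' T"
    define g where "g t x y = F t x y + C' *\<^sub>R x" for t and x y :: 'a
    \<comment> \<open>The interpretations are staged, because the assumptions of
      \<open>monotone_iteration\<close> about \<open>v0\<close> and \<open>w0\<close> are proved
      with comparison facts of the preceding locales.\<close>
    interpret stable_semigroup S M "C' - \<nu>" \<omega>
      unfolding S_def by (rule stable_semigroup_damped[OF T \<nu>(1,2) \<open>\<omega> > 0\<close> \<nu>(3)])
    interpret positive_stable_semigroup S M "C' - \<nu>" \<omega>
      by unfold_locales (use assms(1) positive_semigroup_damped[OF assms(8)] in \<open>auto simp: S_def\<close>)
    have g_cont: "continuous_on UNIV (\<lambda>(t, x, y). g t x y)"
      using continuous_on_add[OF assms(10) continuous_on_scaleR[OF continuous_on_const[of _ C']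
            continuous_on_fst[OF continuous_on_snd[OF continuous_on_id]]]]
      by (simp add: g_def case_prod_unfold)
    have damped_mild: "continuous_on UNIV (\<lambda>t. vector_derivative v (at t) + A (v t) + C' *\<^sub>R v t)"
      "linear_mild_solution S (\<lambda>t. vector_derivative v (at t) + A (v t) + C' *\<^sub>R v t) v"
      if "v \<in> C1_per \<omega> \<inter> C_per_graph \<omega> D A" for v
      using strict_solution_residual[OF T assms(5,7) that] that
      unfolding S_def by (auto simp: C1_per_def C_per_def intro!: linear_mild_solution_damped[OF T] continuous_intros)
    have rhs_cont: "continuous_on UNIV (\<lambda>t. g t (u t) (u (t - \<tau>)))" if "u \<in> C_per \<omega>" for u
      using f_cont[of u] that unfolding g_def f_def[abs_def]
      by (auto simp: C_per_def intro!: continuous_intros)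
    interpret monotone_iteration S M "C' - \<nu>" \<omega> g \<tau> v0 w0
    proof
      show "normal_cone (positive_cone :: 'a set)" "v0 \<le> w0" by fact+
      show "compact_semigroup S" unfolding S_def by (rule compact_semigroup_damped[OF assms(9)])
      show "continuous_on UNIV (\<lambda>(t, x, y). g t x y)" by (rule g_cont)
      show "g (t + \<omega>) x y = g t x y" for t x y by (simp add: g_def assms(11))
      show "v0 \<in> C_per \<omega>" "w0 \<in> C_per \<omega>" by (rule C_per)+
      show "v0 \<le> periodic_solution (\<lambda>t. g t (v0 t) (v0 (t - \<tau>)))"
        by (rule le_periodic_solution[OF damped_mild(2)[OF v0] _ damped_mild(1)[OF v0] rhs_cont])
          (use C_per lower in \<open>auto simp: C_per_def g_def le_fun_def\<close>)
      show "periodic_solution (\<lambda>t. g t (w0 t) (w0 (t - \<tau>))) \<le> w0"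
        by (rule periodic_solution_le[OF damped_mild(2)[OF w0] _ damped_mild(1)[OF w0] rhs_cont])
          (use C_per upper in \<open>auto simp: C_per_def g_def le_fun_def\<close>)
      fix t x1 x2 y1 y2
      assume *: "v0 t \<le> x1" "x1 \<le> x2" "x2 \<le> w0 t"
        "v0 (t - \<tau>) \<le> y1" "y1 \<le> y2" "y2 \<le> w0 (t - \<tau>)"
      \<comment> \<open>The one-sided bound is given for \<open>C\<close>; passing to
        \<open>C' \<ge> C\<close> only adds a nonnegative multiple of
        \<open>x2 - x1\<close>.\<close>
      have "0 \<le> F t x2 y2 - F t x1 y1 + C *\<^sub>R (x2 - x1)"
        using assms(16)[OF *] by (simp add: algebra_simps)
      also have "\<dots> \<le> F t x2 y2 - F t x1 y1 + C' *\<^sub>R (x2 - x1)"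
        using C'(1) *(2) by (intro add_left_mono scaleR_right_mono) auto
      finally show "g t x1 y1 \<le> g t x2 y2" by (simp add: g_def algebra_simps)
    qed
    have Q_eq: "iteration_operator T F \<omega> \<tau> C' = Q"
      unfolding iteration_operator_def[abs_def] Q_def[abs_def] periodic_solution_def[abs_def]
        duhamel_def N_def[abs_def] g_def S_def[symmetric] inv_id_minus ..
    have mild_iff: "periodic_mild_solution T F \<omega> \<tau> u \<longleftrightarrow> Q u = u" if u: "u \<in> C_per \<omega>" for u
    proof -
      have u': "continuous_on UNIV u" "\<And>t. u (t + \<omega>) = u t" using u by (auto simp: C_per_def)
      have N: "N u = (\<lambda>r. f u r + C' *\<^sub>R u r)" by (simp add: N_def[abs_def] g_def f_def)
      have "periodic_mild_solution T F \<omega> \<tau> u \<longleftrightarrow> linear_mild_solution T (f u) u"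
        using u by (simp add: periodic_mild_solution_def linear_mild_solution_def duhamel_def f_def)
      also have "\<dots> \<longleftrightarrow> linear_mild_solution S (N u) u"
        unfolding S_def N by (rule linear_mild_solution_damped_iff[OF T f_cont[OF u'(1)] u'(1), symmetric])
      also have "\<dots> \<longleftrightarrow> Q u = u"
      proof
        assume "linear_mild_solution S (N u) u"
        then show "Q u = u" unfolding Q_def by (rule periodic_solution_unique[of "N u" u, OF _ u'(2), symmetric])
      next
        assume "Q u = u"
        moreover have "linear_mild_solution S (N u) (Q u)"
          unfolding Q_def using N_C_per[OF u] by (intro periodic_solution_mild) (auto simp: C_per_def)
        ultimately show "linear_mild_solution S (N u) u" by simp
      qed
      finally show ?thesis .
    qed
    obtain umin umax where ext: "umin \<in> I" "Q umin = umin" "umax \<in> I" "Q umax = umax"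
      "tendsto_C_per \<omega> (\<lambda>n. (Q ^^ n) v0) umin" "tendsto_C_per \<omega> (\<lambda>n. (Q ^^ n) w0) umax"
      "\<And>u. u \<in> I \<Longrightarrow> Q u = u \<Longrightarrow> umin \<le> u \<and> u \<le> umax"
      using extremal_fixed_points by metis
    have "minimal_maximal_mild_solutions T F \<omega> \<tau> v0 w0 umin umax"
      unfolding minimal_maximal_mild_solutions_def
    proof (intro conjI allI impI)
      show "periodic_mild_solution T F \<omega> \<tau> umin" "periodic_mild_solution T F \<omega> \<tau> umax"
        using ext(1-4) by (simp_all add: mild_iff I_C_per)
      show "v0 \<le> umin" "umax \<le> w0" using ext(1,3) by (auto simp: I_def)
      show "umin \<le> umax" using ext(7)[OF ext(3,4)] by simp
      fix u assume u: "periodic_mild_solution T F \<omega> \<tau> u \<and> v0 \<le> u \<and> u \<le> w0"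
      then have "u \<in> I" by (simp add: I_def periodic_mild_solution_def)
      then show "umin \<le> u" "u \<le> umax" using ext(7)[of u] mild_iff[of u] u I_C_per by auto
    qed
    moreover have "conv C' umin umax"
      unfolding conv_def Let_def Q_eq
      using ext(5,6) funpow_Q_increasing funpow_Q_decreasing
        funpow_Q_mono[OF v0_I w0_I \<open>v0 \<le> w0\<close>] by blast
    ultimately show ?thesis by blast
  qed
  \<comment> \<open>Some admissible constant must exist for the pair to be chosen at all: any
    exponential bound makes \<open>max C (\<nu> + 1)\<close> exceed the growth exponent
    strictly.\<close>
  obtain \<nu> M where "M \<ge> 1" "\<And>t. t \<ge> 0 \<Longrightarrow> norm (T t) \<le> M * exp (\<nu> * t)"
    using C0_semigroup_exponential_bound[OF T] by metis
  then have "growth_exponent T \<le> ereal \<nu>" by (rule growth_exponent_le)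
  also have "ereal \<nu> < ereal (max C (\<nu> + 1))" by (simp only: less_ereal.simps)
  finally obtain umin umax where u: "minimal_maximal_mild_solutions T F \<omega> \<tau> v0 w0 umin umax"
    using main[of "max C (\<nu> + 1)"] by auto
  text \<open>The extremal solutions are unique, so the limits do not depend on \<open>C'\<close>.\<close>
  have "conv C' umin umax" if C': "C' \<ge> C" "growth_exponent T < ereal C'" for C'
  proof -
    obtain umin' umax' where u': "minimal_maximal_mild_solutions T F \<omega> \<tau> v0 w0 umin' umax'"
      and conv: "conv C' umin' umax'" using main[OF C'] by blast
    have "umin' = umin" "umax' = umax"
      using u u' unfolding minimal_maximal_mild_solutions_def
      by (meson order.antisym order.trans)+
    with conv show ?thesis by simp
  qed
  with u show ?thesis unfolding conv_def by blast
qed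

end
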